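(* For every integer $n\geq 3$, Houghton's group $\mathcal{H}_n$ has a presentation with generators $g_1,\dots,g_{n-1},\alpha$ and defining relations $$\alpha^2=1,\qquad (\alpha\,\alpha^{g_1})^3=1,\qquad [\alpha,\alpha^{g_1^2}]=1,$$ $$\alpha=[g_i,g_j],\qquad \alpha^{g_i^{-1}}=\alpha^{g_j^{-1}}\qquad\text{for } 1\leq i\neq j\leq n-1,$$ where the generator $g_i$ corresponds to the translation $g_i\in\mathcal{H}_n$ and $\alpha$ corresponds to the transposition of $Y_n$ exchanging $(1,1)$ and $(1,2)$.
   Context: $\mathbb{N}$ denotes the positive integers. For $n\ge 1$ let $Y_n=\{1,\dots,n\}\times\mathbb{N}$. A bijection $g:Y_n\to Y_n$ (written on the right) is an eventual translation if there are $(m_1,\dots,m_n)\in\mathbb{Z}^n$ and a finite set $K_g\subset Y_n$ such that $(k,p)\cdot g=(k,p+m_k)$ for all $(k,p)\in Y_n-K_g$. Houghton's group $\mathcal{H}_n$ is the group of all eventual translations of $Y_n$; it acts on $Y_n$ on the right, so $gh$ denotes $g$ followed by $h$. For $1\le i\le n-1$ the translation $g_i\in\mathcal{H}_n$ is defined by $(1,p)g_i=(1,p-1)$ for $p\ge 2$, $(1,1)g_i=(i+1,1)$, $(i+1,p)g_i=(i+1,p+1)$ for $p\geq 1$, and $(j,p)g_i=(j,p)$ for $j\ne 1,i+1$. Conventions: $x^{h}=h^{-1}xh$ and $[a,b]=aba^{-1}b^{-1}$. *)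

theory Defs
  imports "HOL-Algebra.Algebra" "HOL-Combinatorics.Transposition"
begin

section \<open>Free groups and group presentations\<close>

text \<open>
  A letter \<open>(True, x)\<close> stands for the generator \<open>x\<close> and \<open>(False, x)\<close> for its formal inverse.
  The free group is realised on reduced words; a product is the reduced form of the concatenation.
\<close>

type_synonym 'a word = "(bool \<times> 'a) list"

definition inv_letter :: "bool \<times> 'a \<Rightarrow> bool \<times> 'a" where
  "inv_letter l = (\<not> fst l, snd l)"

definition reduced :: "'a word \<Rightarrow> bool" where
  "reduced w \<longleftrightarrow> successively (\<lambda>l l'. l' \<noteq> inv_letter l) w"

fun push :: "bool \<times> 'a \<Rightarrow> 'a word \<Rightarrow> 'a word" where
  "push l [] = [l]"
| "push l (l' # w) = (if l' = inv_letter l then w else l # l' # w)"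

definition reduce :: "'a word \<Rightarrow> 'a word" where
  "reduce w = foldr push w []"

definition free_group :: "'a set \<Rightarrow> 'a word monoid" where
  "free_group S =
     \<lparr>carrier = {w. reduced w \<and> snd ` set w \<subseteq> S},
      monoid.mult = (\<lambda>u v. reduce (u @ v)),
      one = []\<rparr>"

definition free_gen :: "'a \<Rightarrow> 'a word" where
  "free_gen x = [(True, x)]"

definition normal_closure :: "('a, 'b) monoid_scheme \<Rightarrow> 'a set \<Rightarrow> 'a set" where
  "normal_closure G A = \<Inter>{N. N \<lhd> G \<and> A \<subseteq> N}"

text \<open>A relation \<open>u = v\<close> is represented by the pair \<open>(u, v)\<close> of elements of the free group.\<close>

definition relators :: "'a set \<Rightarrow> ('a word \<times> 'a word) set \<Rightarrow> 'a word set" where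
  "relators S R = (\<lambda>(u, v). u \<otimes>\<^bsub>free_group S\<^esub> inv\<^bsub>free_group S\<^esub> v) ` R"

definition presented_group ::
    "'a set \<Rightarrow> ('a word \<times> 'a word) set \<Rightarrow> 'a word set monoid" where
  "presented_group S R = free_group S Mod normal_closure (free_group S) (relators S R)"

definition presented_gen ::
    "'a set \<Rightarrow> ('a word \<times> 'a word) set \<Rightarrow> 'a \<Rightarrow> 'a word set" where
  "presented_gen S R x =
     normal_closure (free_group S) (relators S R) #>\<^bsub>free_group S\<^esub> free_gen x"

text \<open>\<open>f\<close> gives the element of \<open>G\<close> to which each abstract generator corresponds.\<close>

definition has_presentation ::
    "('g, 'b) monoid_scheme \<Rightarrow> 'a set \<Rightarrow> ('a word \<times> 'a word) set \<Rightarrow> ('a \<Rightarrow> 'g) \<Rightarrow> bool" where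
  "has_presentation G S R f \<longleftrightarrow>
     (\<exists>\<phi> \<in> iso (presented_group S R) G. \<forall>x \<in> S. \<phi> (presented_gen S R x) = f x)"

lemma inv_letter_inv_letter [simp]: "inv_letter (inv_letter l) = l"
  by (simp add: inv_letter_def)

lemma snd_inv_letter [simp]: "snd (inv_letter l) = snd l"
  by (simp add: inv_letter_def)

lemma reduced_Nil [simp]: "reduced []"
  by (simp add: reduced_def)

lemma reduced_Cons:
  "reduced (l # w) \<longleftrightarrow> reduced w \<and> (case w of [] \<Rightarrow> True | l' # _ \<Rightarrow> l' \<noteq> inv_letter l)"
  by (cases w) (auto simp: reduced_def)

lemma reduced_push: "reduced w \<Longrightarrow> reduced (push l w)"
  by (cases w) (auto simp: reduced_Cons)

lemma reduced_foldr_push: "reduced v \<Longrightarrow> reduced (foldr push u v)"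
  by (induction u) (auto simp: reduced_push)

lemma reduced_reduce: "reduced (reduce w)"
  by (simp add: reduce_def reduced_foldr_push)

lemma push_eq_Cons: "reduced (l # w) \<Longrightarrow> push l w = l # w"
  by (cases w) (auto simp: reduced_Cons)

lemma reduce_reduced: "reduced w \<Longrightarrow> reduce w = w"
proof (induction w)
  case (Cons l w)
  then show ?case using push_eq_Cons[of l w] by (simp add: reduce_def reduced_Cons)
qed (simp add: reduce_def)

lemma push_inv_letter: "reduced w \<Longrightarrow> push (inv_letter l) (push l w) = w"
proof (cases w)
  case (Cons l' v)
  assume "reduced w"
  then show ?thesis using Cons push_eq_Cons[of l' v] by auto
qed simp

lemma foldr_push_push:
  assumes "reduced v"
  shows "foldr push (push l u) v = push l (foldr push u v)"
proof (cases u)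
  case (Cons l' u')
  show ?thesis
    using Cons push_inv_letter[of "foldr push u' v" "inv_letter l"] assms
    by (auto simp: reduced_foldr_push)
qed simp

lemma foldr_push_reduce: "reduced v \<Longrightarrow> foldr push (reduce u) v = foldr push u v"
  by (induction u) (auto simp: reduce_def foldr_push_push)

lemma reduce_append_left: "reduce (reduce u @ v) = reduce (u @ v)"
  using foldr_push_reduce[of "reduce v" u] reduced_reduce[of v]
  by (simp add: reduce_def)

lemma reduce_append_right: "reduce (u @ reduce v) = reduce (u @ v)"
  using reduce_reduced[OF reduced_reduce[of v]] by (simp add: reduce_def)

lemma set_push: "set (push l w) \<subseteq> insert l (set w)"
  by (cases w) auto

lemma set_reduce: "set (reduce w) \<subseteq> set w"
proof (induction w)
  case (Cons l w)
  then show ?case using set_push[of l "reduce w"] by (auto simp: reduce_def)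
qed (simp add: reduce_def)

lemma reduce_inverse: "reduce (rev (map inv_letter w) @ w) = []"
proof (induction w)
  case (Cons l w)
  have "reduce (rev (map inv_letter (l # w)) @ l # w)
      = foldr push (rev (map inv_letter w)) (push (inv_letter l) (push l (reduce w)))"
    by (simp add: reduce_def)
  then show ?case using Cons by (simp add: push_inv_letter reduced_reduce) (simp add: reduce_def)
qed (simp add: reduce_def)

theorem group_free_group: "group (free_group S)"
proof (rule groupI)
  fix u v assume "u \<in> carrier (free_group S)" "v \<in> carrier (free_group S)"
  then show "u \<otimes>\<^bsub>free_group S\<^esub> v \<in> carrier (free_group S)"
    using set_reduce[of "u @ v"] by (fastforce simp: free_group_def reduced_reduce)
next
  fix u assume u: "u \<in> carrier (free_group S)"
  let ?v = "reduce (rev (map inv_letter u))"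
  have "?v \<in> carrier (free_group S)"
    using u set_reduce[of "rev (map inv_letter u)"]
    by (fastforce simp: free_group_def reduced_reduce)
  moreover have "?v \<otimes>\<^bsub>free_group S\<^esub> u = \<one>\<^bsub>free_group S\<^esub>"
    by (simp add: free_group_def reduce_append_left reduce_inverse)
  ultimately show
    "\<exists>v\<in>carrier (free_group S). v \<otimes>\<^bsub>free_group S\<^esub> u = \<one>\<^bsub>free_group S\<^esub>" by blast
qed (auto simp: free_group_def reduce_append_left reduce_append_right reduce_reduced)

lemma free_gen_closed: "x \<in> S \<Longrightarrow> free_gen x \<in> carrier (free_group S)"
  by (simp add: free_gen_def free_group_def reduced_Cons)

lemma (in group) normal_closure_normal:
  assumes "A \<subseteq> carrier G"
  shows "normal_closure G A \<lhd> G"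
proof -
  have "carrier G \<lhd> G"
    by (simp add: normal_inv_iff subgroup_self)
  then have ne: "{N. N \<lhd> G \<and> A \<subseteq> N} \<noteq> {}" using assms by blast
  have "subgroup (normal_closure G A) G"
    unfolding normal_closure_def
    by (rule subgroups_Inter) (use ne normal_imp_subgroup in blast)+
  then show ?thesis
    by (auto simp: normal_inv_iff normal_closure_def)
qed


section \<open>Houghton's groups\<close>

definition Y :: "nat \<Rightarrow> (nat \<times> nat) set" where
  "Y n = {1..n} \<times> {1..}"

definition eventual_translation :: "nat \<Rightarrow> (nat \<times> nat \<Rightarrow> nat \<times> nat) \<Rightarrow> bool" where
  "eventual_translation n g \<longleftrightarrow>
     (\<exists>(m :: nat \<Rightarrow> int) K. finite K \<and> K \<subseteq> Y n \<and>
        (\<forall>(k, p) \<in> Y n - K. fst (g (k, p)) = k \<and> int (snd (g (k, p))) = int p + m k))"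

text \<open>Permutations act on the right, so \<open>g \<otimes> h\<close> is \<open>g\<close> followed by \<open>h\<close>.\<close>

definition houghton :: "nat \<Rightarrow> (nat \<times> nat \<Rightarrow> nat \<times> nat) monoid" where
  "houghton n =
     \<lparr>carrier = {g \<in> Bij (Y n). eventual_translation n g},
      monoid.mult = (\<lambda>g h. compose (Y n) h g),
      one = (\<lambda>x \<in> Y n. x)\<rparr>"

definition translation :: "nat \<Rightarrow> nat \<Rightarrow> nat \<times> nat \<Rightarrow> nat \<times> nat" where
  "translation n i =
     (\<lambda>(j, p) \<in> Y n.
        if j = 1 then (if p = 1 then (i + 1, 1) else (1, p - 1))
        else if j = i + 1 then (i + 1, p + 1)
        else (j, p))"

definition base_transposition :: "nat \<Rightarrow> nat \<times> nat \<Rightarrow> nat \<times> nat" where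
  "base_transposition n = restrict (transpose (1, 1) (1, 2)) (Y n)"

lemma compose_eventual_translation:
  assumes g: "g \<in> Bij (Y n)" "eventual_translation n g" and h: "eventual_translation n h"
  shows "eventual_translation n (compose (Y n) h g)"
proof -
  obtain m K where K: "finite K" "K \<subseteq> Y n"
    "\<And>k p. (k, p) \<in> Y n - K \<Longrightarrow> fst (g (k, p)) = k \<and> int (snd (g (k, p))) = int p + m k"
    using g(2) unfolding eventual_translation_def by fast
  obtain m' K' where K': "finite K'" "K' \<subseteq> Y n"
    "\<And>k p. (k, p) \<in> Y n - K' \<Longrightarrow> fst (h (k, p)) = k \<and> int (snd (h (k, p))) = int p + m' k"
    using h unfolding eventual_translation_def by fast
  have bij: "bij_betw g (Y n) (Y n)" using g(1) by (simp add: Bij_def)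
  let ?K = "K \<union> (g -` K' \<inter> Y n)"
  have fin: "finite ?K"
    using K(1) K'(1) bij by (auto intro: finite_vimage_IntI simp: bij_betw_def)
  have "fst (compose (Y n) h g (k, p)) = k \<and>
      int (snd (compose (Y n) h g (k, p))) = int p + (m k + m' k)"
    if kp: "(k, p) \<in> Y n - ?K" for k p
  proof -
    obtain q where q: "g (k, p) = (k, q)" "int q = int p + m k"
      using K(3)[of k p] kp by (metis DiffD1 DiffD2 DiffI UnCI prod.collapse)
    have "g (k, p) \<in> Y n" using kp bij by (auto dest: bij_betwE)
    then have "(k, q) \<in> Y n - K'" using kp q(1) by auto
    then have "fst (h (g (k, p))) = k \<and> int (snd (h (g (k, p)))) = int p + (m k + m' k)"
      using K'(3)[of k q] q by simp
    then show ?thesis using kp by (simp add: compose_def)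
  qed
  then show ?thesis
    unfolding eventual_translation_def using fin K(2)
    by (intro exI[of _ "\<lambda>k. m k + m' k"] exI[of _ ?K]) auto
qed

lemma inv_eventual_translation:
  assumes g: "g \<in> Bij (Y n)" "eventual_translation n g"
  shows "eventual_translation n (\<lambda>x \<in> Y n. inv_into (Y n) g x)"
proof -
  obtain m K where K: "finite K" "K \<subseteq> Y n"
    "\<And>k p. (k, p) \<in> Y n - K \<Longrightarrow> fst (g (k, p)) = k \<and> int (snd (g (k, p))) = int p + m k"
    using g(2) unfolding eventual_translation_def by fast
  have bij: "bij_betw g (Y n) (Y n)" using g(1) by (simp add: Bij_def)
  have "fst (inv_into (Y n) g (k, q)) = k \<and> int (snd (inv_into (Y n) g (k, q))) = int q - m k"
    if kq: "(k, q) \<in> Y n - g ` K" for k q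
  proof -
    obtain j p where jp: "(j, p) \<in> Y n" "g (j, p) = (k, q)"
      using kq bij by (metis DiffD1 bij_betw_imp_surj_on imageE surj_pair)
    then have "(j, p) \<in> Y n - K" using kq by (metis DiffD2 DiffI image_eqI)
    then have "k = j" "int q = int p + m j" using K(3)[of j p] jp by auto
    moreover have "inv_into (Y n) g (k, q) = (j, p)"
      using bij jp by (metis bij_betw_inv_into_left)
    ultimately show ?thesis by simp
  qed
  moreover have "g ` K \<subseteq> Y n" using K(2) bij by (auto simp: bij_betw_def)
  ultimately show ?thesis
    unfolding eventual_translation_def using K(1)
    by (intro exI[of _ "\<lambda>k. - m k"] exI[of _ "g ` K"]) auto
qed

theorem group_houghton: "group (houghton n)"
proof (rule groupI)
  fix g h assume "g \<in> carrier (houghton n)" "h \<in> carrier (houghton n)"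
  then show "g \<otimes>\<^bsub>houghton n\<^esub> h \<in> carrier (houghton n)"
    by (simp add: houghton_def compose_Bij compose_eventual_translation)
next
  show "\<one>\<^bsub>houghton n\<^esub> \<in> carrier (houghton n)"
    by (auto simp: houghton_def id_Bij eventual_translation_def intro!: exI[of _ "\<lambda>_. 0"] exI[of _ "{}"])
next
  fix g h k assume "g \<in> carrier (houghton n)" "h \<in> carrier (houghton n)" "k \<in> carrier (houghton n)"
  then show "g \<otimes>\<^bsub>houghton n\<^esub> h \<otimes>\<^bsub>houghton n\<^esub> k = g \<otimes>\<^bsub>houghton n\<^esub> (h \<otimes>\<^bsub>houghton n\<^esub> k)"
    by (simp add: houghton_def compose_assoc Bij_imp_funcset)
next
  fix g assume "g \<in> carrier (houghton n)"
  then show "\<one>\<^bsub>houghton n\<^esub> \<otimes>\<^bsub>houghton n\<^esub> g = g"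
    by (auto simp: houghton_def intro: compose_Id Bij_imp_funcset Bij_imp_extensional)
next
  fix g assume g: "g \<in> carrier (houghton n)"
  let ?h = "\<lambda>x \<in> Y n. inv_into (Y n) g x"
  have "?h \<in> carrier (houghton n)"
    using g by (simp add: houghton_def restrict_inv_into_Bij inv_eventual_translation)
  moreover have "?h \<otimes>\<^bsub>houghton n\<^esub> g = \<one>\<^bsub>houghton n\<^esub>"
    using g by (simp add: houghton_def Bij_def bij_betw_def compose_id_inv_into)
  ultimately show "\<exists>h\<in>carrier (houghton n). h \<otimes>\<^bsub>houghton n\<^esub> g = \<one>\<^bsub>houghton n\<^esub>" by blast
qed

lemma translation_closed:
  assumes "1 \<le> i" "i \<le> n - 1"
  shows "translation n i \<in> carrier (houghton n)"
proof -
  let ?b = "\<lambda>(j, p) \<in> Y n.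
        if j = i + 1 then (if p = 1 then (1, 1) else (i + 1, p - 1))
        else if j = 1 then (1, p + 1)
        else (j, p)"
  have "bij_betw (translation n i) (Y n) (Y n)"
    by (rule bij_betw_byWitness[where f' = ?b])
       (use assms in \<open>auto simp: translation_def Y_def split: if_splits\<close>)
  moreover have "eventual_translation n (translation n i)"
    unfolding eventual_translation_def
    by (rule exI[of _ "\<lambda>j. if j = 1 then - 1 else if j = i + 1 then 1 else 0"],
        rule exI[of _ "{(1, 1)}"])
       (use assms in \<open>auto simp: translation_def Y_def split: if_splits\<close>)
  ultimately show ?thesis
    by (auto simp: houghton_def Bij_def translation_def)
qed

lemma base_transposition_closed:
  assumes "1 \<le> n"
  shows "base_transposition n \<in> carrier (houghton n)"
proof -
  have "bij_betw (base_transposition n) (Y n) (Y n)"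
    by (rule bij_betw_byWitness[where f' = "base_transposition n"])
       (use assms in \<open>auto simp: base_transposition_def Y_def transpose_def split: if_splits\<close>)
  moreover have "eventual_translation n (base_transposition n)"
    unfolding eventual_translation_def
    by (rule exI[of _ "\<lambda>_. 0"], rule exI[of _ "{(1, 1), (1, 2)}"])
       (use assms in \<open>auto simp: base_transposition_def Y_def transpose_def\<close>)
  ultimately show ?thesis
    by (auto simp: houghton_def Bij_def base_transposition_def)
qed


section \<open>The generators and relations\<close>

definition conj_by :: "('a, 'b) monoid_scheme \<Rightarrow> 'a \<Rightarrow> 'a \<Rightarrow> 'a" where
  "conj_by G x h = inv\<^bsub>G\<^esub> h \<otimes>\<^bsub>G\<^esub> x \<otimes>\<^bsub>G\<^esub> h"

definition commutator :: "('a, 'b) monoid_scheme \<Rightarrow> 'a \<Rightarrow> 'a \<Rightarrow> 'a" where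
  "commutator G a b = a \<otimes>\<^bsub>G\<^esub> b \<otimes>\<^bsub>G\<^esub> inv\<^bsub>G\<^esub> a \<otimes>\<^bsub>G\<^esub> inv\<^bsub>G\<^esub> b"

datatype houghton_gen = Transl nat | Alpha

definition houghton_gens :: "nat \<Rightarrow> houghton_gen set" where
  "houghton_gens n = insert Alpha (Transl ` {1..n - 1})"

definition houghton_rels :: "nat \<Rightarrow> (houghton_gen word \<times> houghton_gen word) set" where
  "houghton_rels n =
     (let F = free_group (houghton_gens n); \<alpha> = free_gen Alpha; g = (\<lambda>i. free_gen (Transl i)) in
        {(\<alpha> [^]\<^bsub>F\<^esub> (2 :: nat), \<one>\<^bsub>F\<^esub>),
         ((\<alpha> \<otimes>\<^bsub>F\<^esub> conj_by F \<alpha> (g 1)) [^]\<^bsub>F\<^esub> (3 :: nat), \<one>\<^bsub>F\<^esub>),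
         (commutator F \<alpha> (conj_by F \<alpha> (g 1 [^]\<^bsub>F\<^esub> (2 :: nat))), \<one>\<^bsub>F\<^esub>)}
        \<union> {(\<alpha>, commutator F (g i) (g j)) | i j. i \<in> {1..n - 1} \<and> j \<in> {1..n - 1} \<and> i \<noteq> j}
        \<union> {(conj_by F \<alpha> (inv\<^bsub>F\<^esub> g i), conj_by F \<alpha> (inv\<^bsub>F\<^esub> g j)) | i j.
              i \<in> {1..n - 1} \<and> j \<in> {1..n - 1} \<and> i \<noteq> j})"

primrec houghton_gen_image :: "nat \<Rightarrow> houghton_gen \<Rightarrow> nat \<times> nat \<Rightarrow> nat \<times> nat" where
  "houghton_gen_image n (Transl i) = translation n i"
| "houghton_gen_image n Alpha = base_transposition n"

end

theory Submission
  imports Defs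
begin

text \<open>
  The relations hold in \<open>houghton n\<close> by inspection, and the group is generated by the given elements. The
  substance is that the relations suffice. Let \<open>G\<close> be a group with elements \<open>g\<^sub>i\<close> and \<open>\<alpha>\<close> that satisfy
  them, and let \<open>\<sigma>\<^sub>k\<close> be the \<open>k\<close>-fold conjugate \<open>g\<^sub>1\<^sup>k \<alpha> g\<^sub>1\<^sup>-\<^sup>k\<close>; in Houghton's group it is the
  transposition of two neighbours on the first ray.

  First, the \<open>\<sigma>\<^sub>k\<close> satisfy the Coxeter relations, and every \<open>g\<^sub>i\<close>, not only \<open>g\<^sub>1\<close>, conjugates \<open>\<sigma>\<^sub>k\<close> to \<open>\<sigma>\<^sub>k\<^sub>+\<^sub>1\<close>
  (\<open>sigma_shift_and_commute\<close>). The relations give only finitely many instances; the others follow by playing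
  the shifts by \<open>g\<^sub>1\<close> and \<open>g\<^sub>2\<close> against each other, which commute up to the factor \<open>\<alpha>\<close>. The Coxeter relations
  present the finitary permutations of a ray (\<open>sigma_prod_faithful\<close>), so the subgroup \<open>S\<close> generated
  by the \<open>\<sigma>\<^sub>k\<close> is mapped faithfully into Houghton's group.

  Second, \<open>g\<^sub>i S \<subseteq> S g\<^sub>i\<close> and \<open>g\<^sub>i g\<^sub>j \<in> S g\<^sub>j g\<^sub>i\<close>. Hence every element of the group generated by the \<open>g\<^sub>i\<close> and
  \<open>\<alpha>\<close> is of the form \<open>a\<inverse> s b\<close> with \<open>s \<in> S\<close> and positive words \<open>a\<close>, \<open>b\<close> in the \<open>g\<^sub>i\<close> (\<open>generated_normal_form\<close>).
  On the rays other than the first, a positive word is the translation outwards by its letter counts and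
  \<open>s\<close> is the identity. So if \<open>a\<inverse> s b\<close> represents the identity, \<open>a\<close> and \<open>b\<close> have the same letter counts, thus
  \<open>b \<in> S a\<close>, and the element is conjugate to an element of \<open>S\<close> that acts trivially
  (\<open>realisation_faithful\<close>). It is therefore trivial.

  The same shape proves generation: given a permutation \<open>h\<close> in \<open>houghton n\<close>, one chooses positive words \<open>a\<close> and \<open>b\<close>
  such that \<open>a h b\<inverse>\<close> is a finitary permutation of the first ray (\<open>houghton_normal_form\<close>).
\<close>

section \<open>Groups given by generators and relations\<close>

fun letter_value :: "('g, 'b) monoid_scheme \<Rightarrow> ('a \<Rightarrow> 'g) \<Rightarrow> bool \<times> 'a \<Rightarrow> 'g" where
  "letter_value G f (b, x) = (if b then f x else inv\<^bsub>G\<^esub> f x)"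

definition word_value :: "('g, 'b) monoid_scheme \<Rightarrow> ('a \<Rightarrow> 'g) \<Rightarrow> 'a word \<Rightarrow> 'g" where
  "word_value G f w = foldr (\<lambda>l y. letter_value G f l \<otimes>\<^bsub>G\<^esub> y) w \<one>\<^bsub>G\<^esub>"

context group
begin

lemma word_value_simps [simp]:
  "word_value G f [] = \<one>"
  "word_value G f (l # w) = letter_value G f l \<otimes> word_value G f w"
  by (simp_all add: word_value_def)

lemma letter_value_closed [simp]:
  assumes "f ` S \<subseteq> carrier G" "snd l \<in> S"
  shows "letter_value G f l \<in> carrier G"
  using assms by (cases l) auto

lemma word_value_closed [simp]:
  assumes "f ` S \<subseteq> carrier G" "snd ` set w \<subseteq> S"
  shows "word_value G f w \<in> carrier G"
  using assms by (induction w) auto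

lemma word_value_append:
  assumes "f ` S \<subseteq> carrier G" "snd ` set u \<subseteq> S" "snd ` set v \<subseteq> S"
  shows "word_value G f (u @ v) = word_value G f u \<otimes> word_value G f v"
  using assms by (induction u) (auto simp: m_assoc)

text \<open>
  The only case with content is the cancellation in \<open>push\<close>, where the letter meets its inverse; this
  is what makes evaluation insensitive to reduction, hence multiplicative on the free group.
\<close>

lemma word_value_push:
  assumes "f ` S \<subseteq> carrier G" "snd l \<in> S" "snd ` set w \<subseteq> S"
  shows "word_value G f (push l w) = letter_value G f l \<otimes> word_value G f w"
proof (cases w)
  case (Cons l' v)
  have "letter_value G f l \<otimes> (letter_value G f (inv_letter l) \<otimes> word_value G f v) = word_value G f v"
    using assms Cons
    by (cases l) (auto simp: inv_letter_def image_subset_iff m_assoc [symmetric])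
  then show ?thesis using Cons by auto
qed simp

lemma word_value_reduce:
  assumes "f ` S \<subseteq> carrier G" "snd ` set w \<subseteq> S"
  shows "word_value G f (reduce w) = word_value G f w"
  using assms(2)
proof (induction w)
  case (Cons l w)
  have "snd ` set (reduce w) \<subseteq> S" using set_reduce[of w] Cons.prems by auto
  then show ?case
    using Cons word_value_push[OF assms(1), of l "reduce w"] by (simp add: reduce_def)
qed (simp add: reduce_def)

lemma word_value_hom:
  assumes "f ` S \<subseteq> carrier G"
  shows "group_hom (free_group S) G (word_value G f)"
proof -
  have "word_value G f \<in> hom (free_group S) G"
    using assms word_value_append[OF assms] word_value_reduce[OF assms]
    by (intro homI) (auto simp: free_group_def image_Un)
  then show ?thesis
    by (simp add: group_hom_def group_hom_axioms_def group_free_group is_group)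
qed

lemma word_value_free_gen:
  assumes "f ` S \<subseteq> carrier G" "x \<in> S"
  shows "word_value G f (free_gen x) = f x"
  using assms by (simp add: free_gen_def image_subset_iff)

end

lemma inv_free_gen:
  assumes "x \<in> S"
  shows "inv\<^bsub>free_group S\<^esub> free_gen x = [(False, x)]"
  by (rule group.inv_equality[OF group_free_group])
     (use assms in \<open>auto simp: free_group_def free_gen_def reduce_def reduced_Cons inv_letter_def\<close>)

lemma free_group_generated: "generate (free_group S) (free_gen ` S) = carrier (free_group S)"
proof
  interpret F: group "free_group S" by (rule group_free_group)
  show "generate (free_group S) (free_gen ` S) \<subseteq> carrier (free_group S)"
    by (rule F.generate_incl) (auto simp: free_gen_closed)
  show "carrier (free_group S) \<subseteq> generate (free_group S) (free_gen ` S)"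
  proof
    fix w assume "w \<in> carrier (free_group S)"
    then show "w \<in> generate (free_group S) (free_gen ` S)"
    proof (induction w)
      case Nil
      then show ?case using generate.one[of "free_group S"] by (simp add: free_group_def)
    next
      case (Cons l w)
      obtain b x where l: "l = (b, x)" by fastforce
      have x: "x \<in> S" and w: "w \<in> carrier (free_group S)"
        using Cons.prems l by (auto simp: free_group_def reduced_Cons)
      have "[l] \<in> generate (free_group S) (free_gen ` S)"
      proof (cases b)
        case True
        then show ?thesis using l x by (auto intro!: generate.incl simp: free_gen_def)
      next
        case False
        then show ?thesis using generate.inv[of "free_gen x" "free_gen ` S" "free_group S"] l x
          by (simp add: inv_free_gen)
      qed
      moreover have "[l] \<otimes>\<^bsub>free_group S\<^esub> w = l # w"
        using Cons.prems by (simp add: free_group_def reduce_reduced)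
      ultimately show ?case
        using generate.eng[OF _ Cons.IH[OF w]] by metis
    qed
  qed
qed

locale presentation =
  fixes S :: "'a set" and R :: "('a word \<times> 'a word) set"
  assumes relations_closed: "R \<subseteq> carrier (free_group S) \<times> carrier (free_group S)"
begin

abbreviation "N \<equiv> normal_closure (free_group S) (relators S R)"

lemma normal_relators: "N \<lhd> free_group S"
proof -
  interpret F: group "free_group S" by (rule group_free_group)
  show ?thesis
    using relations_closed by (intro F.normal_closure_normal) (auto simp: relators_def)
qed

lemma quotient_map_hom:
  "group_hom (free_group S) (presented_group S R) (\<lambda>w. N #>\<^bsub>free_group S\<^esub> w)"
  by (simp add: group_hom_def group_hom_axioms_def group_free_group presented_group_def
      normal_relators normal.factorgroup_is_group normal.r_coset_hom_Mod)

lemma group_presented_group: "group (presented_group S R)"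
  using quotient_map_hom by (simp add: group_hom_def)

lemma relator_in_N:
  assumes "(u, v) \<in> R"
  shows "u \<otimes>\<^bsub>free_group S\<^esub> inv\<^bsub>free_group S\<^esub> v \<in> N"
  using assms by (auto simp: normal_closure_def relators_def)

lemma quotient_map_relation:
  assumes "(u, v) \<in> R"
  shows "N #>\<^bsub>free_group S\<^esub> u = N #>\<^bsub>free_group S\<^esub> v"
proof -
  interpret F: group "free_group S" by (rule group_free_group)
  have "u \<in> carrier (free_group S)" "v \<in> carrier (free_group S)"
    using assms relations_closed by auto
  moreover have "subgroup N (free_group S)"
    by (rule normal_imp_subgroup[OF normal_relators])
  moreover have "u \<in> N #>\<^bsub>free_group S\<^esub> v"
    using relator_in_N[OF assms] calculation
    by (auto simp: r_coset_def F.m_assoc intro!: bexI[of _ "u \<otimes>\<^bsub>free_group S\<^esub> inv\<^bsub>free_group S\<^esub> v"])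
  ultimately show ?thesis
    using F.repr_independence by metis
qed

lemma presented_group_generated:
  "generate (presented_group S R) (presented_gen S R ` S) = carrier (presented_group S R)"
proof -
  interpret q: group_hom "free_group S" "presented_group S R" "\<lambda>w. N #>\<^bsub>free_group S\<^esub> w"
    by (rule quotient_map_hom)
  have "presented_gen S R ` S = (\<lambda>w. N #>\<^bsub>free_group S\<^esub> w) ` free_gen ` S"
    by (auto simp: presented_gen_def)
  moreover have "free_gen ` S \<subseteq> carrier (free_group S)"
    by (auto simp: free_gen_closed)
  ultimately show ?thesis
    using q.generate_img[of "free_gen ` S"]
    by (simp add: free_group_generated carrier_FactGroup presented_group_def)
qed

text \<open>
  The universal property of a presentation: the kernel of \<open>\<epsilon>\<close> is normal and contains the relators,
  so it contains their normal closure.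
\<close>

lemma presented_group_universal:
  assumes "group_hom (free_group S) G \<epsilon>" "\<And>u v. (u, v) \<in> R \<Longrightarrow> \<epsilon> u = \<epsilon> v"
  obtains \<psi> where "group_hom (presented_group S R) G \<psi>"
    "\<And>x. x \<in> S \<Longrightarrow> \<psi> (presented_gen S R x) = \<epsilon> (free_gen x)"
proof -
  interpret \<epsilon>: group_hom "free_group S" G \<epsilon> by fact
  have "relators S R \<subseteq> kernel (free_group S) G \<epsilon>"
    using assms(2) relations_closed by (fastforce simp: relators_def kernel_def)
  then have "N \<subseteq> kernel (free_group S) G \<epsilon>"
    using \<epsilon>.normal_kernel by (auto simp: normal_closure_def)
  from \<epsilon>.FactGroup_universal_kernel[OF normal_relators this] obtain \<psi> where
    "\<psi> \<in> hom (free_group S Mod N) G"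
    "\<And>w. w \<in> carrier (free_group S) \<Longrightarrow> \<psi> (N #>\<^bsub>free_group S\<^esub> w) = \<epsilon> w"
    by blast
  then show thesis
    by (intro that[of \<psi>])
       (auto simp: group_hom_def group_hom_axioms_def group_presented_group presented_gen_def
         free_gen_closed \<epsilon>.H.is_group simp flip: presented_group_def)
qed

text \<open>
  To establish a presentation it is enough to check the relations in \<open>G\<close>, to generate \<open>G\<close>, and to
  show that the induced homomorphism \<open>\<psi>\<close> has trivial kernel. The last point is phrased for an
  arbitrary \<open>\<psi>\<close> with the right values on the generators, so that it can be proved inside the
  presented group without reference to words.
\<close>

lemma has_presentationI:
  assumes "group_hom (free_group S) G \<epsilon>" "\<And>u v. (u, v) \<in> R \<Longrightarrow> \<epsilon> u = \<epsilon> v"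
    and f: "\<And>x. x \<in> S \<Longrightarrow> \<epsilon> (free_gen x) = f x"
    and gen: "carrier G \<subseteq> generate G (f ` S)"
    and inj: "\<And>\<psi> z. \<lbrakk>group_hom (presented_group S R) G \<psi>; \<And>x. x \<in> S \<Longrightarrow> \<psi> (presented_gen S R x) = f x;
      z \<in> carrier (presented_group S R); \<psi> z = \<one>\<^bsub>G\<^esub>\<rbrakk> \<Longrightarrow> z = \<one>\<^bsub>presented_group S R\<^esub>"
  shows "has_presentation G S R f"
proof -
  obtain \<psi> where "group_hom (presented_group S R) G \<psi>"
    and "\<And>x. x \<in> S \<Longrightarrow> \<psi> (presented_gen S R x) = \<epsilon> (free_gen x)"
    using presented_group_universal assms(1,2) by blast
  then have \<psi>: "\<And>x. x \<in> S \<Longrightarrow> \<psi> (presented_gen S R x) = f x"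
    and hom: "group_hom (presented_group S R) G \<psi>"
    by (simp_all add: f)
  interpret \<psi>: group_hom "presented_group S R" G \<psi> by fact
  have "f ` S = \<psi> ` presented_gen S R ` S"
    using \<psi> by (auto simp: image_iff)
  moreover have "presented_gen S R ` S \<subseteq> carrier (presented_group S R)"
    by (auto simp: generate.incl simp flip: presented_group_generated)
  ultimately have "carrier G \<subseteq> \<psi> ` carrier (presented_group S R)"
    using gen \<psi>.generate_img[of "presented_gen S R ` S"] by (simp add: presented_group_generated)
  then have "\<psi> \<in> iso (presented_group S R) G"
    using inj[OF hom \<psi>]
    by (auto simp: iso_kernel_image[OF \<psi>.G.is_group \<psi>.H.is_group] kernel_def)
  then show ?thesis
    using \<psi> by (auto simp: has_presentation_def)
qed

end

section \<open>Conjugation, and involutions satisfying the braid relations\<close>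

text \<open>
  The opposite convention to \<^const>\<open>conj_by\<close>: here \<open>h\<close> acts from the left, so that
  \<open>conjugate (h \<otimes> k) = conjugate h \<circ> conjugate k\<close> and iterated conjugates compose in reading order.
\<close>

definition (in group) conjugate :: "'a \<Rightarrow> 'a \<Rightarrow> 'a" where
  "conjugate h x = h \<otimes> x \<otimes> inv h"

context group
begin

lemma conjugate_closed [simp]:
  "h \<in> carrier G \<Longrightarrow> x \<in> carrier G \<Longrightarrow> conjugate h x \<in> carrier G"
  by (simp add: conjugate_def)

lemma conjugate_one: "x \<in> carrier G \<Longrightarrow> conjugate \<one> x = x"
  by (simp add: conjugate_def)

lemma conjugate_mult_left:
  assumes "h \<in> carrier G" "k \<in> carrier G" "x \<in> carrier G"
  shows "conjugate (h \<otimes> k) x = conjugate h (conjugate k x)"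
  using assms by (simp add: conjugate_def inv_mult_group m_assoc)

lemma mult_conjugate:
  assumes "h \<in> carrier G" "x \<in> carrier G"
  shows "h \<otimes> x = conjugate h x \<otimes> h"
  using assms by (simp add: conjugate_def m_assoc)

lemma conjugate_mult_right:
  assumes "h \<in> carrier G" "x \<in> carrier G" "y \<in> carrier G"
  shows "conjugate h (x \<otimes> y) = conjugate h x \<otimes> conjugate h y"
  using assms by (simp add: conjugate_def m_assoc) (simp add: m_assoc [symmetric])

lemma inv_mult_cancel_left:
  assumes "x \<in> carrier G" "y \<in> carrier G"
  shows "inv x \<otimes> (x \<otimes> y) = y" "x \<otimes> (inv x \<otimes> y) = y"
  using assms by (simp_all add: m_assoc [symmetric])

lemma conjugate_eq_iff_mult:
  assumes "h \<in> carrier G" "x \<in> carrier G" "y \<in> carrier G"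
  shows "conjugate h x = y \<longleftrightarrow> h \<otimes> x = y \<otimes> h"
  using assms inv_solve_right'[of y "h \<otimes> x" h] by (simp add: conjugate_def)

text \<open>
  Conjugation by \<open>h\<close> is an automorphism, so it may be applied to both arguments of another conjugation.
  Used with commutation written as \<open>conjugate a b = b\<close>, it transports commutation relations.
\<close>

lemma conjugate_conjugate:
  assumes "h \<in> carrier G" "k \<in> carrier G" "x \<in> carrier G"
  shows "conjugate (conjugate h k) (conjugate h x) = conjugate h (conjugate k x)"
proof -
  have "conjugate (conjugate h k) (conjugate h x) = conjugate (conjugate h k \<otimes> h) x"
    using assms by (simp add: conjugate_mult_left)
  then show ?thesis using assms by (simp add: mult_conjugate [symmetric] conjugate_mult_left)
qed

lemma conj_by_eq_conjugate:
  "h \<in> carrier G \<Longrightarrow> x \<in> carrier G \<Longrightarrow> conj_by G x h = conjugate (inv h) x"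
  by (simp add: conj_by_def conjugate_def)

lemma commutator_eq_iff:
  assumes "a \<in> carrier G" "b \<in> carrier G" "c \<in> carrier G"
  shows "c = commutator G a b \<longleftrightarrow> a \<otimes> b = c \<otimes> b \<otimes> a"
  using assms by (simp add: commutator_def inv_solve_right inv_solve_right')

text \<open>
  With \<open>u = x \<otimes> y \<otimes> x\<close> and \<open>v = y \<otimes> x \<otimes> y\<close> the cube is \<open>u \<otimes> v\<close>, and \<open>v\<close> is an involution.
\<close>

lemma involutions_cube_iff_braid:
  assumes "x \<in> carrier G" "y \<in> carrier G" "x \<otimes> x = \<one>" "y \<otimes> y = \<one>"
  shows "(x \<otimes> y) [^] (3 :: nat) = \<one> \<longleftrightarrow> x \<otimes> y \<otimes> x = y \<otimes> x \<otimes> y"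
proof -
  have "(x \<otimes> y) [^] (3 :: nat) = (x \<otimes> y \<otimes> x) \<otimes> (y \<otimes> x \<otimes> y)"
    using assms(1,2) by (simp add: eval_nat_numeral m_assoc)
  moreover have "inv (y \<otimes> x \<otimes> y) = y \<otimes> x \<otimes> y"
    using assms inv_equality[of x x] inv_equality[of y y] by (simp add: inv_mult_group m_assoc)
  ultimately show ?thesis
    using assms inv_solve_right'[of "\<one>" "x \<otimes> y \<otimes> x" "y \<otimes> x \<otimes> y"] by simp
qed

end

text \<open>
  The Coxeter relations of the group of finitary permutations of the natural numbers, where \<open>\<sigma> k\<close>
  stands for the transposition of \<open>k\<close> and \<open>k + 1\<close>. That these relations suffice is proved in \<open>sigma_prod_faithful\<close> below.
\<close>

locale braid_involutions = group G for G (structure) +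
  fixes \<sigma> :: "nat \<Rightarrow> 'a"
  assumes sigma_closed [simp]: "\<sigma> k \<in> carrier G"
    and sigma_involution: "\<sigma> k \<otimes> \<sigma> k = \<one>"
    and sigma_braid: "\<sigma> k \<otimes> \<sigma> (Suc k) \<otimes> \<sigma> k = \<sigma> (Suc k) \<otimes> \<sigma> k \<otimes> \<sigma> (Suc k)"
    and sigma_commute: "Suc k < l \<Longrightarrow> \<sigma> k \<otimes> \<sigma> l = \<sigma> l \<otimes> \<sigma> k"
begin

definition sigma_prod :: "nat list \<Rightarrow> 'a" where
  "sigma_prod ps = foldr (\<lambda>k x. \<sigma> k \<otimes> x) ps \<one>"

lemma sigma_prod_simps [simp]:
  "sigma_prod [] = \<one>"
  "sigma_prod (k # ps) = \<sigma> k \<otimes> sigma_prod ps"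
  by (simp_all add: sigma_prod_def)

lemma sigma_prod_closed [simp]: "sigma_prod ps \<in> carrier G"
  by (induction ps) auto

lemma sigma_prod_append: "sigma_prod (ps @ qs) = sigma_prod ps \<otimes> sigma_prod qs"
  by (induction ps) (auto simp: m_assoc)

lemma sigma_prod_rev: "sigma_prod (rev ps) \<otimes> sigma_prod ps = \<one>"
proof (induction ps)
  case (Cons k ps)
  have "sigma_prod (rev ps) \<otimes> \<sigma> k \<otimes> (\<sigma> k \<otimes> sigma_prod ps)
    = sigma_prod (rev ps) \<otimes> (\<sigma> k \<otimes> \<sigma> k) \<otimes> sigma_prod ps"
    by (simp only: m_assoc m_closed sigma_closed sigma_prod_closed)
  then show ?case using Cons by (simp add: sigma_prod_append sigma_involution)
qed simp

lemma inv_sigma_prod: "inv (sigma_prod ps) = sigma_prod (rev ps)"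
  by (rule inv_equality) (auto simp: sigma_prod_rev)

lemma sigma_commute_prod:
  assumes "\<And>k. k \<in> set ps \<Longrightarrow> Suc j < k \<or> Suc k < j"
  shows "\<sigma> j \<otimes> sigma_prod ps = sigma_prod ps \<otimes> \<sigma> j"
  using assms
proof (induction ps)
  case (Cons k ps)
  have "\<sigma> j \<otimes> \<sigma> k = \<sigma> k \<otimes> \<sigma> j"
    using sigma_commute[of j k] sigma_commute[of k j] Cons.prems[of k] by auto
  then have "\<sigma> j \<otimes> (\<sigma> k \<otimes> sigma_prod ps) = \<sigma> k \<otimes> (\<sigma> j \<otimes> sigma_prod ps)"
    by (simp add: m_assoc [symmetric])
  then show ?case using Cons by (simp add: m_assoc)
qed simp

text \<open>
  Moving \<open>\<sigma> j\<close> through the cycle \<open>\<sigma> k \<otimes> \<dots> \<otimes> \<sigma> (m - 1)\<close> lowers its index by one: it passes everything below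
  \<open>j - 1\<close>, one braid relation turns it into \<open>\<sigma> (j - 1)\<close>, and that passes everything above \<open>j\<close>.
\<close>

lemma sigma_times_descent:
  assumes "k < j" "j < m"
  shows "\<sigma> j \<otimes> sigma_prod [k..<m] = sigma_prod [k..<m] \<otimes> \<sigma> (j - 1)"
proof -
  obtain i where i: "j = Suc i" "k \<le> i" using assms(1) by (cases j) auto
  have split: "sigma_prod [k..<m] = sigma_prod [k..<i] \<otimes> (\<sigma> i \<otimes> \<sigma> j \<otimes> sigma_prod [Suc j..<m])"
  proof -
    have "[k..<m] = [k..<i] @ i # j # [Suc j..<m]"
      using assms i by (metis le_Suc_ex less_imp_le_nat upt_add_eq_append upt_conv_Cons Suc_lessD)
    then show ?thesis by (simp add: sigma_prod_append m_assoc)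
  qed
  let ?A = "sigma_prod [k..<i]" and ?B = "sigma_prod [Suc j..<m]"
  have A: "\<sigma> j \<otimes> ?A = ?A \<otimes> \<sigma> j" by (rule sigma_commute_prod) (auto simp: i)
  have B: "\<sigma> i \<otimes> ?B = ?B \<otimes> \<sigma> i" by (rule sigma_commute_prod) (auto simp: i)
  have "\<sigma> j \<otimes> sigma_prod [k..<m] = (\<sigma> j \<otimes> ?A) \<otimes> (\<sigma> i \<otimes> \<sigma> j \<otimes> ?B)"
    by (simp add: split m_assoc)
  also have "\<dots> = ?A \<otimes> (\<sigma> j \<otimes> \<sigma> i \<otimes> \<sigma> j) \<otimes> ?B"
    by (simp only: A) (simp add: m_assoc)
  also have "\<dots> = ?A \<otimes> (\<sigma> i \<otimes> \<sigma> j) \<otimes> (\<sigma> i \<otimes> ?B)"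
    by (simp only: i sigma_braid [symmetric]) (simp add: m_assoc)
  also have "\<dots> = sigma_prod [k..<m] \<otimes> \<sigma> i"
    by (simp only: B) (simp add: split m_assoc)
  finally show ?thesis by (simp add: i)
qed

text \<open>
  The products \<open>\<sigma> k \<otimes> \<dots> \<otimes> \<sigma> m\<close>, for \<open>k \<le> m + 1\<close>, represent all left cosets of the subgroup generated by
  \<open>\<sigma> 0, \<dots>, \<sigma> (m - 1)\<close> in the one generated by \<open>\<sigma> 0, \<dots>, \<sigma> m\<close>. It suffices that left
  multiplication by each \<open>\<sigma> j\<close> permutes these cosets; in the symmetric group they are told apart by
  the preimage \<open>k\<close> of the top point \<open>m + 1\<close>.
\<close>

lemma sigma_prod_coset:
  assumes "set ps \<subseteq> {..<Suc m}"
  shows "\<exists>k\<le>Suc m. \<exists>qs. set qs \<subseteq> {..<m} \<and> sigma_prod ps = sigma_prod [k..<Suc m] \<otimes> sigma_prod qs"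
  using assms
proof (induction ps)
  case Nil
  show ?case by (rule exI[of _ "Suc m"]) (auto intro!: exI[of _ "[]"])
next
  case (Cons j ps)
  then obtain k qs where k: "k \<le> Suc m" and qs: "set qs \<subseteq> {..<m}"
    and eq: "sigma_prod ps = sigma_prod [k..<Suc m] \<otimes> sigma_prod qs" by auto
  have j: "j \<le> m" using Cons.prems by auto
  have eq': "sigma_prod (j # ps) = \<sigma> j \<otimes> sigma_prod [k..<Suc m] \<otimes> sigma_prod qs"
    by (simp add: eq m_assoc del: upt_Suc)
  consider "j = k" | "Suc j = k" | "Suc j < k" | "k < j" by linarith
  then show ?case
  proof cases
    case 1
    then have upt: "[k..<Suc m] = j # [Suc j..<Suc m]"
      using j by (simp add: upt_conv_Cons del: upt_Suc)
    have "sigma_prod (j # ps) = sigma_prod [Suc j..<Suc m] \<otimes> sigma_prod qs"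
      unfolding eq' upt by (simp add: m_assoc [symmetric] sigma_involution del: upt_Suc)
    then show ?thesis using j qs by (intro exI[of _ "Suc j"]) auto
  next
    case 2
    then have upt: "[j..<Suc m] = j # [k..<Suc m]"
      using j by (simp add: upt_conv_Cons del: upt_Suc)
    have "sigma_prod (j # ps) = sigma_prod [j..<Suc m] \<otimes> sigma_prod qs"
      unfolding eq' upt by (simp del: upt_Suc)
    then show ?thesis using j qs by (intro exI[of _ j]) auto
  next
    case 3
    have "\<sigma> j \<otimes> sigma_prod [k..<Suc m] = sigma_prod [k..<Suc m] \<otimes> \<sigma> j"
      by (rule sigma_commute_prod) (use 3 in auto)
    then have "sigma_prod (j # ps) = sigma_prod [k..<Suc m] \<otimes> sigma_prod (j # qs)"
      unfolding eq' by (simp add: m_assoc del: upt_Suc)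
    moreover have "set (j # qs) \<subseteq> {..<m}" using qs 3 k by auto
    ultimately show ?thesis using k by blast
  next
    case 4
    have "sigma_prod (j # ps) = sigma_prod [k..<Suc m] \<otimes> sigma_prod ((j - 1) # qs)"
      unfolding eq' using sigma_times_descent[of k j "Suc m"] 4 j
      by (simp add: m_assoc del: upt_Suc)
    moreover have "set ((j - 1) # qs) \<subseteq> {..<m}" using qs 4 j by auto
    ultimately show ?thesis using k by blast
  qed
qed

end

text \<open>
  A right action in which \<open>\<sigma> k\<close> exchanges the points numbered \<open>k\<close> and \<open>k + 1\<close>. Multiplicativity is
  demanded on the numbered points only, to allow for permutations of \<open>Y n\<close>, which do not compose
  outside \<open>Y n\<close>.
\<close>

locale braid_action = braid_involutions +
  fixes act :: "'a \<Rightarrow> 'p \<Rightarrow> 'p" and pt :: "nat \<Rightarrow> 'p"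
  assumes inj_pt: "inj pt"
    and act_one: "act \<one> (pt q) = pt q"
    and act_mult: "x \<in> carrier G \<Longrightarrow> y \<in> carrier G \<Longrightarrow> act (x \<otimes> y) (pt q) = act y (act x (pt q))"
    and act_sigma: "act (\<sigma> k) (pt q) = pt (transpose k (Suc k) q)"
begin

lemma act_sigma_prod_descent: "k \<le> m \<Longrightarrow> act (sigma_prod [k..<m]) (pt k) = pt m"
proof (induction rule: inc_induct)
  case base
  show ?case by (simp add: act_one)
next
  case (step k)
  then show ?case
    by (simp add: upt_conv_Cons act_mult act_sigma)
qed

lemma act_sigma_prod_above: "set ps \<subseteq> {..<m} \<Longrightarrow> m < q \<Longrightarrow> act (sigma_prod ps) (pt q) = pt q"
  by (induction ps) (auto simp: act_one act_mult act_sigma transpose_def)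

text \<open>
  The Coxeter relations present the symmetric group, by induction on the number of generators: write the
  element as a coset representative times \<open>u\<close>. The representative sends \<open>k\<close> to the top point, which \<open>u\<close>
  fixes, so an element acting trivially has the trivial representative \<open>k = Suc m\<close>.
\<close>

lemma sigma_prod_faithful_bounded:
  assumes "set ps \<subseteq> {..<m}" "\<And>q. act (sigma_prod ps) (pt q) = pt q"
  shows "sigma_prod ps = \<one>"
  using assms
proof (induction m arbitrary: ps)
  case (Suc m)
  obtain k qs where k: "k \<le> Suc m" and qs: "set qs \<subseteq> {..<m}"
    and eq: "sigma_prod ps = sigma_prod [k..<Suc m] \<otimes> sigma_prod qs"
    using sigma_prod_coset[OF Suc.prems(1)] by blast
  have "pt k = pt (Suc m)"
    using Suc.prems(2)[of k] act_sigma_prod_descent[OF k] act_sigma_prod_above[OF qs]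
    by (simp add: eq act_mult del: upt_Suc)
  then have "k = Suc m" using inj_pt by (simp add: inj_eq)
  then have "sigma_prod ps = sigma_prod qs" by (simp add: eq)
  then show ?case using Suc.IH[OF qs] Suc.prems(2) by simp
qed simp

lemma sigma_prod_faithful:
  assumes "\<And>q. act (sigma_prod ps) (pt q) = pt q"
  shows "sigma_prod ps = \<one>"
proof -
  obtain m where "\<forall>k\<in>set ps. k < m"
    using finite_nat_set_iff_bounded[of "set ps"] by auto
  then show ?thesis using sigma_prod_faithful_bounded[of ps m] assms by auto
qed

end

section \<open>Consequences of Houghton's relations\<close>

text \<open>
  A group with elements satisfying Houghton's relations; both the abstractly presented group and the
  permutation group \<open>houghton n\<close> are instances.
\<close>

locale houghton_relations = group G for G (structure) +
  fixes n :: nat and g :: "nat \<Rightarrow> 'a" and \<alpha> :: 'a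
  assumes g_in_carrier: "i \<in> {1..n - 1} \<Longrightarrow> g i \<in> carrier G"
    and alpha_closed [simp]: "\<alpha> \<in> carrier G"
    and alpha_pow: "\<alpha> [^] (2 :: nat) = \<one>"
    and alpha_cube: "(\<alpha> \<otimes> conj_by G \<alpha> (g 1)) [^] (3 :: nat) = \<one>"
    and alpha_commutator: "commutator G \<alpha> (conj_by G \<alpha> (g 1 [^] (2 :: nat))) = \<one>"
    and g_commutator: "\<lbrakk>i \<in> {1..n - 1}; j \<in> {1..n - 1}; i \<noteq> j\<rbrakk> \<Longrightarrow> \<alpha> = commutator G (g i) (g j)"
    and g_conj: "\<lbrakk>i \<in> {1..n - 1}; j \<in> {1..n - 1}; i \<noteq> j\<rbrakk> \<Longrightarrow>
      conj_by G \<alpha> (inv (g i)) = conj_by G \<alpha> (inv (g j))"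
    and n_ge_3: "n \<ge> 3"
begin

lemma g_closed [simp]: "\<lbrakk>1 \<le> i; i \<le> n - 1\<rbrakk> \<Longrightarrow> g i \<in> carrier G"
  by (simp add: g_in_carrier)

lemma g12_closed [simp]: "g 1 \<in> carrier G" "g (Suc 0) \<in> carrier G" "g 2 \<in> carrier G"
  using g_closed[of 1] g_closed[of 2] n_ge_3 by auto

lemma alpha_involution: "\<alpha> \<otimes> \<alpha> = \<one>"
  using alpha_pow by (simp add: eval_nat_numeral)

lemma g_swap: "\<lbrakk>i \<in> {1..n - 1}; j \<in> {1..n - 1}; i \<noteq> j\<rbrakk> \<Longrightarrow> g i \<otimes> g j = \<alpha> \<otimes> g j \<otimes> g i"
  using g_commutator commutator_eq_iff by simp

text \<open>
  The elements meant to be the transpositions of the adjacent points \<open>(1, k + 1)\<close> and \<open>(1, k + 2)\<close> of the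
  first ray: \<open>conjugate (g 1)\<close> moves the support of a permutation by the inverse of \<open>g 1\<close>, which is
  outwards on the first ray.
\<close>

definition \<sigma> :: "nat \<Rightarrow> 'a" where
  "\<sigma> k = (conjugate (g 1) ^^ k) \<alpha>"

lemma sigma_0: "\<sigma> 0 = \<alpha>"
  by (simp add: \<sigma>_def)

lemma sigma_Suc: "\<sigma> (Suc k) = conjugate (g 1) (\<sigma> k)"
  by (simp add: \<sigma>_def)

lemma sigma_in_carrier [simp]: "\<sigma> k \<in> carrier G"
  by (induction k) (auto simp: sigma_0 sigma_Suc)

lemma sigma_squared: "\<sigma> k \<otimes> \<sigma> k = \<one>"
proof (induction k)
  case (Suc k)
  then show ?case
    using conjugate_mult_right[of "g 1" "\<sigma> k" "\<sigma> k", symmetric]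
    by (simp add: sigma_Suc) (simp add: conjugate_def)
qed (simp add: sigma_0 alpha_involution)

lemma conjugate_sigma_sigma: "x \<in> carrier G \<Longrightarrow> conjugate (\<sigma> k) (conjugate (\<sigma> k) x) = x"
  by (simp add: conjugate_mult_left [symmetric] sigma_squared conjugate_one)

lemma sigma_shift_0:
  assumes "i \<in> {1..n - 1}"
  shows "conjugate (g i) (\<sigma> 0) = \<sigma> 1"
  using g_conj[of i 1] assms n_ge_3
  by (cases "i = 1") (auto simp: sigma_Suc sigma_0 conj_by_eq_conjugate)

text \<open>
  The relation concerns \<open>\<alpha>\<close> and the transposition \<open>\<beta>\<close> just inside it, across the junction of two rays.
  Conjugating by \<open>g 1\<close> moves both onto the first ray, where they become \<open>\<sigma> 1\<close> and \<open>\<sigma> 0\<close>; the next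
  lemma uses the same device with \<open>g 1 [^] 2\<close>.
\<close>

lemma sigma_braid_0: "\<sigma> 0 \<otimes> \<sigma> 1 \<otimes> \<sigma> 0 = \<sigma> 1 \<otimes> \<sigma> 0 \<otimes> \<sigma> 1"
proof -
  define \<beta> where "\<beta> = conjugate (inv (g 1)) \<alpha>"
  have [simp]: "\<beta> \<in> carrier G" by (simp add: \<beta>_def)
  have \<beta>: "conjugate (g 1) \<beta> = \<sigma> 0"
    by (simp add: \<beta>_def sigma_0 conjugate_mult_left [symmetric] conjugate_one)
  have "\<beta> \<otimes> \<beta> = \<one>"
    by (simp add: \<beta>_def conjugate_mult_right [symmetric] alpha_involution) (simp add: conjugate_def)
  then have "\<alpha> \<otimes> \<beta> \<otimes> \<alpha> = \<beta> \<otimes> \<alpha> \<otimes> \<beta>"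
    using alpha_cube involutions_cube_iff_braid[of \<alpha> \<beta>]
    by (simp add: conj_by_eq_conjugate alpha_involution \<beta>_def)
  then have "conjugate (g 1) (\<alpha> \<otimes> \<beta> \<otimes> \<alpha>) = conjugate (g 1) (\<beta> \<otimes> \<alpha> \<otimes> \<beta>)" by simp
  then show ?thesis
    using \<beta> by (simp add: conjugate_mult_right sigma_0 sigma_Suc)
qed

lemma sigma_commute_0_2: "conjugate (\<sigma> 0) (\<sigma> 2) = \<sigma> 2"
proof -
  define \<beta> where "\<beta> = conjugate (inv (g 1 [^] (2 :: nat))) \<alpha>"
  have [simp]: "\<beta> \<in> carrier G" by (simp add: \<beta>_def)
  have \<beta>: "conjugate (g 1 [^] (2 :: nat)) \<beta> = \<alpha>"
    by (simp add: \<beta>_def conjugate_mult_left [symmetric] conjugate_one)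
  have \<sigma>2: "conjugate (g 1 [^] (2 :: nat)) \<alpha> = \<sigma> 2"
    by (simp add: eval_nat_numeral conjugate_mult_left sigma_0 sigma_Suc)
  have "\<alpha> \<otimes> \<beta> = \<beta> \<otimes> \<alpha>"
    using alpha_commutator commutator_eq_iff[of \<alpha> \<beta> \<one>]
    by (simp add: \<beta>_def conj_by_eq_conjugate)
  then have "conjugate (g 1 [^] (2 :: nat)) (\<alpha> \<otimes> \<beta>) = conjugate (g 1 [^] (2 :: nat)) (\<beta> \<otimes> \<alpha>)" by simp
  then have "\<sigma> 2 \<otimes> \<alpha> = \<alpha> \<otimes> \<sigma> 2"
    by (simp add: conjugate_mult_right \<beta> \<sigma>2 del: One_nat_def)
  then show ?thesis by (simp add: conjugate_eq_iff_mult sigma_0)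
qed

text \<open>
  In the language of conjugation actions, write \<open>s\<^sub>0 s\<^sub>1 s\<^sub>0 z = s\<^sub>1 s\<^sub>0 s\<^sub>1 z\<close> for the braid relation. The
  hypotheses turn the left side into \<open>z\<close> and the right side into \<open>s\<^sub>0 z\<close>.
\<close>

lemma sigma_commute_step:
  assumes 1: "conjugate (\<sigma> 1) z = z"
    and 2: "conjugate (\<sigma> 1) (conjugate (\<sigma> 0) z) = conjugate (\<sigma> 0) z"
    and z: "z \<in> carrier G"
  shows "conjugate (\<sigma> 0) z = z"
proof -
  have "z = conjugate (\<sigma> 0) (conjugate (\<sigma> 1) (conjugate (\<sigma> 0) z))"
    using z by (simp add: 2 conjugate_sigma_sigma del: One_nat_def)
  also have "\<dots> = conjugate (\<sigma> 1) (conjugate (\<sigma> 0) (conjugate (\<sigma> 1) z))"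
    using z sigma_braid_0 by (simp add: conjugate_mult_left [symmetric] m_assoc)
  also have "\<dots> = conjugate (\<sigma> 0) z"
    by (simp only: 1 2)
  finally show ?thesis by (rule sym)
qed

text \<open>
  All the \<open>g i\<close> should shift the \<open>\<sigma> k\<close> in the same way as \<open>g 1\<close>. Swapping \<open>g i\<close> with \<open>g 1\<close> costs a factor
  \<open>\<alpha>\<close>, so the shift is known only up to conjugation by \<open>\<sigma> 0\<close>.
\<close>

lemma sigma_shift_step:
  assumes i: "i \<in> {1..n - 1}" "i \<noteq> 1" and "conjugate (g i) (\<sigma> k) = \<sigma> (Suc k)"
  shows "conjugate (g i) (\<sigma> (Suc k)) = conjugate (\<sigma> 0) (\<sigma> (Suc (Suc k)))"
proof -
  have "conjugate (g i) (\<sigma> (Suc k)) = conjugate (g i \<otimes> g 1) (\<sigma> k)"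
    using i by (simp add: sigma_Suc conjugate_mult_left)
  also have "\<dots> = conjugate (\<alpha> \<otimes> g 1 \<otimes> g i) (\<sigma> k)"
    using g_swap[of i 1] i n_ge_3 by simp
  also have "\<dots> = conjugate (\<sigma> 0) (\<sigma> (Suc (Suc k)))"
    using i assms(3) by (simp add: conjugate_mult_left sigma_0 sigma_Suc)
  finally show ?thesis .
qed

text \<open>
  The shift property at \<open>k + 1\<close> needs that \<open>\<sigma> 0\<close> commutes with \<open>\<sigma> (k + 2)\<close>, and that commutation is given
  by the relations for \<open>k = 0\<close> only. Both are therefore proved together. This is where a second
  generator \<open>g 2\<close>, hence \<open>n \<ge> 3\<close>, enters: transporting one commutation relation by \<open>g 1\<close> and by \<open>g 2\<close>
  gives two different relations for the next index, and the braid relation combines them.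
\<close>

lemma sigma_shift_and_commute:
  "(\<forall>i \<in> {1..n - 1}. conjugate (g i) (\<sigma> k) = \<sigma> (Suc k)) \<and>
   conjugate (\<sigma> 0) (\<sigma> (k + 2)) = \<sigma> (k + 2)"
proof (induction k)
  case 0
  show ?case using sigma_shift_0 sigma_commute_0_2 by (simp add: numeral_2_eq_2)
next
  case (Suc k)
  have shift: "conjugate (g i) (\<sigma> (Suc k)) = \<sigma> (Suc (Suc k))" if "i \<in> {1..n - 1}" for i
  proof (cases "i = 1")
    case True
    then show ?thesis by (simp only: sigma_Suc)
  next
    case False
    then show ?thesis using Suc sigma_shift_step[OF that, of k] that by simp
  qed
  have 2: "2 \<in> {1..n - 1}" using n_ge_3 by simp
  let ?z = "\<sigma> (k + 3)"
  have "conjugate (\<sigma> 1) (conjugate (\<sigma> 0) ?z) = conjugate (\<sigma> 0) ?z"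
  proof -
    \<comment> \<open>Shifting by \<open>g 2\<close> is known one index lower only, which leaves a conjugation by \<open>\<sigma> 0\<close>.\<close>
    have "conjugate (g 2) (\<sigma> (k + 2)) = conjugate (\<sigma> 0) ?z"
      using sigma_shift_step[OF 2 _ shift[OF 2]] by (simp add: eval_nat_numeral)
    moreover have "conjugate (g 2) (\<sigma> 0) = \<sigma> 1" by (rule sigma_shift_0[OF 2])
    moreover have "conjugate (conjugate (g 2) (\<sigma> 0)) (conjugate (g 2) (\<sigma> (k + 2)))
        = conjugate (g 2) (\<sigma> (k + 2))"
      using Suc by (simp add: conjugate_conjugate)
    ultimately show ?thesis by simp
  qed
  moreover have "conjugate (\<sigma> 1) ?z = ?z"
  proof -
    have "conjugate (conjugate (g 1) (\<sigma> 0)) (conjugate (g 1) (\<sigma> (k + 2)))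
        = conjugate (g 1) (\<sigma> (k + 2))"
      using Suc by (simp add: conjugate_conjugate)
    then show ?thesis by (simp only: sigma_Suc [symmetric]) (simp add: eval_nat_numeral)
  qed
  ultimately have "conjugate (\<sigma> 0) ?z = ?z" by (intro sigma_commute_step) auto
  then show ?case using shift by (simp add: eval_nat_numeral)
qed

lemma sigma_shift: "i \<in> {1..n - 1} \<Longrightarrow> g i \<otimes> \<sigma> k = \<sigma> (Suc k) \<otimes> g i"
  using sigma_shift_and_commute[of k] by (simp add: conjugate_eq_iff_mult)

sublocale braid_involutions G \<sigma>
proof
  fix k l :: nat
  show "\<sigma> k \<otimes> \<sigma> (Suc k) \<otimes> \<sigma> k = \<sigma> (Suc k) \<otimes> \<sigma> k \<otimes> \<sigma> (Suc k)"
  proof (induction k)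
    case 0
    show ?case using sigma_braid_0 by simp
  next
    case (Suc k)
    have "conjugate (g 1) (\<sigma> k \<otimes> \<sigma> (Suc k) \<otimes> \<sigma> k)
        = conjugate (g 1) (\<sigma> (Suc k) \<otimes> \<sigma> k \<otimes> \<sigma> (Suc k))" using Suc by simp
    then show ?case by (simp add: conjugate_mult_right sigma_Suc)
  qed
  assume "Suc k < l"
  then obtain d where l: "l = d + 2 + k" by (metis add.commute add_2_eq_Suc' less_natE add_Suc_shift add_Suc)
  have "conjugate (\<sigma> k) (\<sigma> (d + 2 + k)) = \<sigma> (d + 2 + k)"
  proof (induction k)
    case 0
    show ?case using sigma_shift_and_commute[of d] by simp
  next
    case (Suc k)
    have "conjugate (\<sigma> (Suc k)) (\<sigma> (Suc (d + 2 + k))) = conjugate (g 1) (conjugate (\<sigma> k) (\<sigma> (d + 2 + k)))"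
      by (simp add: sigma_Suc conjugate_conjugate)
    then show ?case by (simp only: Suc sigma_Suc add_Suc_right)
  qed
  then show "\<sigma> k \<otimes> \<sigma> l = \<sigma> l \<otimes> \<sigma> k"
    by (simp add: conjugate_eq_iff_mult l)
qed (simp_all add: sigma_squared)

definition g_prod :: "nat list \<Rightarrow> 'a" where
  "g_prod as = foldr (\<lambda>i x. g i \<otimes> x) as \<one>"

lemma g_prod_simps [simp]:
  "g_prod [] = \<one>"
  "g_prod (i # as) = g i \<otimes> g_prod as"
  by (simp_all add: g_prod_def)

lemma g_prod_closed [simp]: "set as \<subseteq> {1..n - 1} \<Longrightarrow> g_prod as \<in> carrier G"
  by (induction as) auto

lemma g_prod_append:
  "\<lbrakk>set as \<subseteq> {1..n - 1}; set bs \<subseteq> {1..n - 1}\<rbrakk> \<Longrightarrow> g_prod (as @ bs) = g_prod as \<otimes> g_prod bs"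
  by (induction as) (auto simp: m_assoc)

lemma g_sigma_prod:
  assumes "i \<in> {1..n - 1}"
  shows "g i \<otimes> sigma_prod ps = sigma_prod (map Suc ps) \<otimes> g i"
proof (induction ps)
  case (Cons k ps)
  have "g i \<otimes> (\<sigma> k \<otimes> sigma_prod ps) = \<sigma> (Suc k) \<otimes> (g i \<otimes> sigma_prod ps)"
    using assms sigma_shift[OF assms, of k] by (simp add: m_assoc [symmetric])
  then show ?case using Cons assms by (simp add: m_assoc)
qed (use assms in simp)

text \<open>
  Positive words in the \<open>g i\<close> conjugate the subgroup of the \<open>\<sigma> k\<close> into itself. In Houghton's group
  this inclusion is proper, because conjugation by the inverse words also yields permutations that move
  points of other rays. So rewriting works in one direction only.
\<close>

lemma g_prod_sigma_prod:
  assumes "set as \<subseteq> {1..n - 1}"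
  obtains qs where "g_prod as \<otimes> sigma_prod ps = sigma_prod qs \<otimes> g_prod as"
  using assms
proof (induction as arbitrary: thesis)
  case Nil
  then show ?case by simp
next
  case (Cons i as)
  then obtain qs where qs: "g_prod as \<otimes> sigma_prod ps = sigma_prod qs \<otimes> g_prod as" by auto
  have i: "i \<in> {1..n - 1}" and as: "set as \<subseteq> {1..n - 1}" using Cons.prems(2) by auto
  have "g i \<otimes> (sigma_prod qs \<otimes> g_prod as) = sigma_prod (map Suc qs) \<otimes> (g i \<otimes> g_prod as)"
    using i as g_sigma_prod[OF i, of qs] by (simp add: m_assoc [symmetric])
  then have "g_prod (i # as) \<otimes> sigma_prod ps = sigma_prod (map Suc qs) \<otimes> g_prod (i # as)"
    using i as qs by (simp add: m_assoc)
  then show ?case by (rule Cons.prems(1))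
qed

lemma g_g_prod:
  assumes "i \<in> {1..n - 1}" "set as \<subseteq> {1..n - 1}"
  obtains ps where "g i \<otimes> g_prod as = sigma_prod ps \<otimes> g_prod as \<otimes> g i"
  using assms(2)
proof (induction as arbitrary: thesis)
  case Nil
  then show ?case using assms(1) Nil(1)[of "[]"] by simp
next
  case (Cons j as)
  then obtain ps where ps: "g i \<otimes> g_prod as = sigma_prod ps \<otimes> g_prod as \<otimes> g i" by auto
  have j: "j \<in> {1..n - 1}" and as: "set as \<subseteq> {1..n - 1}" using Cons.prems(2) by auto
  obtain qs where qs: "g i \<otimes> g j = sigma_prod qs \<otimes> g j \<otimes> g i"
  proof (cases "i = j")
    case True
    then show ?thesis using that[of "[]"] j by simp
  next
    case False
    then show ?thesis using that[of "[0]"] g_swap[OF assms(1) j] by (simp add: sigma_0)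
  qed
  have "g i \<otimes> g_prod (j # as) = sigma_prod qs \<otimes> g j \<otimes> (g i \<otimes> g_prod as)"
    using assms(1) j as qs by (simp add: m_assoc [symmetric])
  also have "\<dots> = sigma_prod qs \<otimes> (g j \<otimes> sigma_prod ps) \<otimes> g_prod as \<otimes> g i"
    using assms(1) j as by (simp add: ps m_assoc)
  also have "\<dots> = sigma_prod (qs @ map Suc ps) \<otimes> g_prod (j # as) \<otimes> g i"
    using assms(1) j as by (simp add: g_sigma_prod[OF j] sigma_prod_append m_assoc)
  finally show ?case by (rule Cons.prems(1))
qed

text \<open>
  Two generators \<open>g i\<close>, \<open>g j\<close> commute up to \<open>\<alpha> = \<sigma> 0\<close>, and such factors can be collected on the left. So
  rearranging a positive word changes its value by a product of the \<open>\<sigma> k\<close> on the left.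
\<close>

lemma g_prod_mset_eq:
  assumes "set as \<subseteq> {1..n - 1}" "mset as = mset bs"
  obtains ps where "g_prod bs = sigma_prod ps \<otimes> g_prod as"
  using assms
proof (induction as arbitrary: bs thesis)
  case Nil
  then show ?case using Nil(1)[of "[]"] by simp
next
  case (Cons i as)
  have i: "i \<in> {1..n - 1}" and as: "set as \<subseteq> {1..n - 1}" using Cons.prems(2) by auto
  have "i \<in> set bs" using Cons.prems(3) by (metis list.set_intros(1) mset_eq_setD)
  then obtain us vs where bs: "bs = us @ i # vs" by (meson split_list)
  then have eq: "mset as = mset (us @ vs)" using Cons.prems(3) by simp
  then have "set (us @ vs) = set as" by (metis mset_eq_setD)
  then have us: "set us \<subseteq> {1..n - 1}" and vs: "set vs \<subseteq> {1..n - 1}" using as by auto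
  obtain ps where ps: "g_prod (us @ vs) = sigma_prod ps \<otimes> g_prod as"
    using Cons.IH[OF _ as eq] by blast
  obtain qs where qs: "g i \<otimes> g_prod us = sigma_prod qs \<otimes> g_prod us \<otimes> g i"
    using g_g_prod[OF i us] by blast
  have "sigma_prod qs \<otimes> g_prod bs = (g i \<otimes> g_prod us) \<otimes> g_prod vs"
    using i us vs by (simp add: bs g_prod_append qs m_assoc)
  also have "\<dots> = sigma_prod (map Suc ps) \<otimes> g_prod (i # as)"
    using i us vs as ps g_sigma_prod[OF i, of ps]
    by (simp add: m_assoc g_prod_append) (simp add: m_assoc [symmetric])
  finally have "sigma_prod (rev qs) \<otimes> (sigma_prod qs \<otimes> g_prod bs)
      = sigma_prod (rev qs) \<otimes> (sigma_prod (map Suc ps) \<otimes> g_prod (i # as))" by simp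
  then have "g_prod bs = sigma_prod (rev qs @ map Suc ps) \<otimes> g_prod (i # as)"
    using i us vs as bs sigma_prod_rev[of qs]
    by (simp add: m_assoc [symmetric] sigma_prod_append)
  then show ?case by (rule Cons.prems(1))
qed

text \<open>
  Fractions of positive words with a finitary permutation of the first ray in between. An inverse
  generator on the right can be moved into the denominator on the left, because \<open>g i\<close> commutes with positive words
  up to products of the \<open>\<sigma> k\<close>; this is an Ore condition.
\<close>

definition normal_forms :: "'a set" where
  "normal_forms = {inv (g_prod as) \<otimes> sigma_prod ps \<otimes> g_prod bs | as ps bs.
     set as \<subseteq> {1..n - 1} \<and> set bs \<subseteq> {1..n - 1}}"

lemma normal_forms_g:
  assumes "x \<in> normal_forms" "i \<in> {1..n - 1}"
  shows "x \<otimes> g i \<in> normal_forms"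
proof -
  obtain as ps bs where as: "set as \<subseteq> {1..n - 1}" and bs: "set bs \<subseteq> {1..n - 1}"
    and x: "x = inv (g_prod as) \<otimes> sigma_prod ps \<otimes> g_prod bs"
    using assms(1) by (auto simp: normal_forms_def)
  have "x \<otimes> g i = inv (g_prod as) \<otimes> sigma_prod ps \<otimes> g_prod (bs @ [i])"
    using as bs assms(2) by (simp add: x g_prod_append m_assoc)
  then show ?thesis unfolding normal_forms_def using as bs assms(2) by (fastforce)
qed

lemma normal_forms_alpha:
  assumes "x \<in> normal_forms"
  shows "x \<otimes> \<alpha> \<in> normal_forms"
proof -
  obtain as ps bs where as: "set as \<subseteq> {1..n - 1}" and bs: "set bs \<subseteq> {1..n - 1}"
    and x: "x = inv (g_prod as) \<otimes> sigma_prod ps \<otimes> g_prod bs"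
    using assms(1) by (auto simp: normal_forms_def)
  obtain qs where "g_prod bs \<otimes> sigma_prod [0] = sigma_prod qs \<otimes> g_prod bs"
    using g_prod_sigma_prod[OF bs] by blast
  then have qs: "g_prod bs \<otimes> \<alpha> = sigma_prod qs \<otimes> g_prod bs" by (simp add: sigma_0)
  have "x \<otimes> \<alpha> = inv (g_prod as) \<otimes> sigma_prod (ps @ qs) \<otimes> g_prod bs"
    using as bs by (simp add: x sigma_prod_append m_assoc qs)
  then show ?thesis unfolding normal_forms_def using as bs by blast
qed

lemma normal_forms_inv_g:
  assumes "x \<in> normal_forms" "i \<in> {1..n - 1}"
  shows "x \<otimes> inv (g i) \<in> normal_forms"
proof -
  obtain as ps bs where as: "set as \<subseteq> {1..n - 1}" and bs: "set bs \<subseteq> {1..n - 1}"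
    and x: "x = inv (g_prod as) \<otimes> sigma_prod ps \<otimes> g_prod bs"
    using assms(1) by (auto simp: normal_forms_def)
  note closed = as bs assms(2)
  obtain qs where qs: "g i \<otimes> g_prod bs = sigma_prod qs \<otimes> g_prod bs \<otimes> g i"
    using g_g_prod[OF assms(2) bs] by blast
  have i_ps: "g i \<otimes> sigma_prod ps = sigma_prod (map Suc ps) \<otimes> g i"
    by (rule g_sigma_prod[OF assms(2)])
  have "inv (g_prod (i # as)) \<otimes> sigma_prod (map Suc ps @ qs) \<otimes> g_prod bs \<otimes> g i
      = inv (g_prod as) \<otimes> inv (g i) \<otimes> (sigma_prod (map Suc ps) \<otimes> (sigma_prod qs \<otimes> g_prod bs \<otimes> g i))"
    using closed by (simp add: sigma_prod_append m_assoc inv_mult_group)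
  also have "\<dots> = inv (g_prod as) \<otimes> inv (g i) \<otimes> (sigma_prod (map Suc ps) \<otimes> g i) \<otimes> g_prod bs"
    using closed by (simp add: qs [symmetric] m_assoc)
  also have "\<dots> = x"
    using closed by (simp add: i_ps [symmetric] x m_assoc inv_mult_cancel_left)
  finally have "x \<otimes> inv (g i) = inv (g_prod (i # as)) \<otimes> sigma_prod (map Suc ps @ qs) \<otimes> g_prod bs"
    using closed by (intro iffD2[OF inv_solve_right']) auto
  then show ?thesis unfolding normal_forms_def using closed by fastforce
qed

theorem generated_normal_form:
  assumes "x \<in> generate G (insert \<alpha> (g ` {1..n - 1}))"
  obtains as ps bs where "set as \<subseteq> {1..n - 1}" "set bs \<subseteq> {1..n - 1}"
    "x = inv (g_prod as) \<otimes> sigma_prod ps \<otimes> g_prod bs"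
proof -
  have gens: "insert \<alpha> (g ` {1..n - 1}) \<subseteq> carrier G" by auto
  have sub: "normal_forms \<subseteq> carrier G" by (auto simp: normal_forms_def)
  have inv_alpha: "inv \<alpha> = \<alpha>"
    by (rule inv_equality) (simp_all add: alpha_involution)
  have "\<forall>y \<in> normal_forms. y \<otimes> x \<in> normal_forms"
    using assms
  proof (induction rule: generate.induct)
    case one
    show ?case using sub by auto
  next
    case (incl h)
    then show ?case using normal_forms_g normal_forms_alpha by auto
  next
    case (inv h)
    then show ?case using normal_forms_inv_g normal_forms_alpha by (auto simp: inv_alpha)
  next
    case (eng x y)
    then have xy: "x \<in> carrier G" "y \<in> carrier G" using generate_in_carrier[OF gens] by auto
    show ?case
    proof
      fix z assume z: "z \<in> normal_forms"
      then have "z \<in> carrier G" using sub by auto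
      then have "z \<otimes> (x \<otimes> y) = z \<otimes> x \<otimes> y" using xy by (simp add: m_assoc)
      then show "z \<otimes> (x \<otimes> y) \<in> normal_forms" using eng.IH z by simp
    qed
  qed
  moreover have "\<one> \<in> normal_forms"
    unfolding normal_forms_def by (auto intro!: exI[of _ "[]"])
  ultimately have "\<one> \<otimes> x \<in> normal_forms" by blast
  then have "x \<in> normal_forms" using generate_in_carrier[OF gens assms] by simp
  then show thesis using that by (auto simp: normal_forms_def)
qed

end

section \<open>The relations hold in Houghton's group\<close>

lemma houghton_mult_apply [simp]:
  "z \<in> Y n \<Longrightarrow> (x \<otimes>\<^bsub>houghton n\<^esub> y) z = y (x z)"
  by (simp add: houghton_def compose_def)

lemma houghton_one_apply [simp]: "z \<in> Y n \<Longrightarrow> \<one>\<^bsub>houghton n\<^esub> z = z"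
  by (simp add: houghton_def)

lemma houghton_bij: "x \<in> carrier (houghton n) \<Longrightarrow> bij_betw x (Y n) (Y n)"
  by (simp add: houghton_def Bij_def)

lemma houghton_apply_closed [simp]: "x \<in> carrier (houghton n) \<Longrightarrow> z \<in> Y n \<Longrightarrow> x z \<in> Y n"
  using houghton_bij bij_betwE by blast

lemma houghton_apply_eq_iff [simp]:
  "\<lbrakk>x \<in> carrier (houghton n); z \<in> Y n; w \<in> Y n\<rbrakk> \<Longrightarrow> x z = x w \<longleftrightarrow> z = w"
  using houghton_bij[of x n] by (auto simp: bij_betw_def inj_on_eq_iff)

text \<open>
  Elements of \<open>houghton n\<close> are functions that are undefined outside \<open>Y n\<close>, so agreement on \<open>Y n\<close> suffices.
\<close>

lemma houghton_eqI:
  assumes "x \<in> carrier (houghton n)" "y \<in> carrier (houghton n)" "\<And>z. z \<in> Y n \<Longrightarrow> x z = y z"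
  shows "x = y"
  using assms by (intro extensionalityI[of x "Y n" y]) (auto simp: houghton_def Bij_def)

lemma houghton_inv_apply:
  assumes "x \<in> carrier (houghton n)" "z \<in> Y n"
  shows "(inv\<^bsub>houghton n\<^esub> x) (x z) = z"
proof -
  interpret H: group "houghton n" by (rule group_houghton)
  have "(x \<otimes>\<^bsub>houghton n\<^esub> inv\<^bsub>houghton n\<^esub> x) z = z" using assms by simp
  then show ?thesis using assms by (simp del: H.r_inv H.Units_r_inv)
qed

definition transposition :: "nat \<Rightarrow> nat \<times> nat \<Rightarrow> nat \<times> nat \<Rightarrow> nat \<times> nat \<Rightarrow> nat \<times> nat" where
  "transposition n x y = restrict (transpose x y) (Y n)"

lemma transposition_apply [simp]: "z \<in> Y n \<Longrightarrow> transposition n x y z = transpose x y z"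
  by (simp add: transposition_def)

lemma transposition_closed [simp]:
  assumes "x \<in> Y n" "y \<in> Y n"
  shows "transposition n x y \<in> carrier (houghton n)"
proof -
  have "bij_betw (transposition n x y) (Y n) (Y n)"
    by (rule bij_betw_byWitness[where f' = "transpose x y"])
       (use assms in \<open>auto simp: transpose_def split: if_splits\<close>)
  moreover have "eventual_translation n (transposition n x y)"
    unfolding eventual_translation_def
    by (rule exI[of _ "\<lambda>_. 0"], rule exI[of _ "{x, y}"]) (use assms in \<open>auto simp: transpose_def\<close>)
  ultimately show ?thesis
    by (auto simp: houghton_def Bij_def transposition_def)
qed

lemma base_transposition_eq: "base_transposition n = transposition n (1, 1) (1, 2)"
  by (simp add: base_transposition_def transposition_def)

text \<open>
  The inverse-free form of the conjugation rule for permutations acting on the right. With it the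
  relations about conjugates of \<open>\<alpha>\<close> become statements on two moved points.
\<close>

lemma transposition_mult:
  assumes "h \<in> carrier (houghton n)" "x \<in> Y n" "y \<in> Y n"
  shows "transposition n x y \<otimes>\<^bsub>houghton n\<^esub> h = h \<otimes>\<^bsub>houghton n\<^esub> transposition n (h x) (h y)"
proof -
  interpret H: group "houghton n" by (rule group_houghton)
  show ?thesis
    by (rule houghton_eqI[of _ n]) (use assms in \<open>auto simp: transpose_def\<close>)
qed

lemma conj_by_transposition:
  assumes "h \<in> carrier (houghton n)" "x \<in> Y n" "y \<in> Y n"
  shows "conj_by (houghton n) (transposition n x y) h = transposition n (h x) (h y)"
proof -
  interpret H: group "houghton n" by (rule group_houghton)
  show ?thesis
    using assms by (simp add: conj_by_def H.m_assoc transposition_mult)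
      (simp add: H.m_assoc [symmetric])
qed

lemma translation_apply:
  "(j, p) \<in> Y n \<Longrightarrow> translation n i (j, p) =
     (if j = 1 then (if p = 1 then (i + 1, 1) else (1, p - 1))
      else if j = i + 1 then (i + 1, p + 1)
      else (j, p))"
  by (simp add: translation_def)

lemma translation_in_houghton: "i \<in> {1..n - 1} \<Longrightarrow> translation n i \<in> carrier (houghton n)"
  by (simp add: translation_closed)

text \<open>
  The commutator relation in a form without inverses, which can be compared point by point.
\<close>

lemma translation_swap:
  assumes "i \<in> {1..n - 1}" "j \<in> {1..n - 1}" "i \<noteq> j"
  shows "translation n i \<otimes>\<^bsub>houghton n\<^esub> translation n j =
    transposition n (1, 1) (1, 2) \<otimes>\<^bsub>houghton n\<^esub> translation n j \<otimes>\<^bsub>houghton n\<^esub> translation n i"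
proof -
  interpret H: group "houghton n" by (rule group_houghton)
  have closed: "translation n i \<in> carrier (houghton n)" "translation n j \<in> carrier (houghton n)"
    using assms by (simp_all add: translation_in_houghton)
  have [simp]: "(1, 1) \<in> Y n" "(Suc 0, Suc 0) \<in> Y n" "(1, 2) \<in> Y n" "(Suc 0, 2) \<in> Y n"
    using assms by (auto simp: Y_def)
  show ?thesis
  proof (rule houghton_eqI[of _ n])
    fix z assume z: "z \<in> Y n"
    have [simp]: "transpose (1, 1) (1, 2) z \<in> Y n" 
      using z by (simp add: transpose_def)
    obtain k p where kp: "z = (k, p)" by fastforce
    then have "1 \<le> k" "k \<le> n" "1 \<le> p" using z by (auto simp: Y_def)
    then show "(translation n i \<otimes>\<^bsub>houghton n\<^esub> translation n j) z =
      (transposition n (1, 1) (1, 2) \<otimes>\<^bsub>houghton n\<^esub> translation n j \<otimes>\<^bsub>houghton n\<^esub> translation n i) z"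
      using z assms closed
      by (auto simp: kp translation_def Y_def transpose_def)
  qed (use closed in auto)
qed

text \<open>
  The conjugates of \<open>\<alpha>\<close> in the relations are the transpositions of the points \<open>(2, 1), (1, 1)\<close> (conjugating by
  \<open>g 1\<close>), of \<open>(2, 2), (2, 1)\<close> (by its square) and of \<open>(1, 2), (1, 3)\<close> (by the inverse of
  any \<open>g i\<close>).
\<close>

theorem houghton_relations_houghton:
  assumes "n \<ge> 3"
  shows "houghton_relations (houghton n) n (translation n) (base_transposition n)"
proof -
  interpret H: group "houghton n" by (rule group_houghton)
  let ?\<alpha> = "transposition n (1, 1) (1, 2)"
  have Y [simp]: "(Suc 0, Suc 0) \<in> Y n" "(Suc 0, 2) \<in> Y n" "(Suc 0, 3) \<in> Y n" "(2, Suc 0) \<in> Y n" "(2, 2) \<in> Y n"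
    "(Suc 0, Suc (Suc 0)) \<in> Y n" "(Suc (Suc 0), Suc 0) \<in> Y n" "(Suc (Suc 0), Suc (Suc 0)) \<in> Y n"
    using assms by (auto simp: Y_def)
  have g1: "translation n 1 \<in> carrier (houghton n)" using assms by (simp add: translation_closed)
  have conj1: "conj_by (houghton n) ?\<alpha> (translation n 1) = transposition n (2, 1) (1, 1)"
    using g1 by (simp add: conj_by_transposition) (simp add: translation_apply numeral_2_eq_2)
  have conj2: "conj_by (houghton n) ?\<alpha> (translation n 1 [^]\<^bsub>houghton n\<^esub> (2 :: nat))
    = transposition n (2, 2) (2, 1)"
    using g1 Y by (simp add: conj_by_transposition numeral_2_eq_2 translation_apply)
  have conj_inv: "conj_by (houghton n) ?\<alpha> (inv\<^bsub>houghton n\<^esub> translation n i) = transposition n (1, 2) (1, 3)"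
    if "i \<in> {1..n - 1}" for i
  proof -
    have g: "translation n i \<in> carrier (houghton n)" using that by (simp add: translation_in_houghton)
    have "translation n i (1, 2) = (1, 1)" "translation n i (1, 3) = (1, 2)"
      by (simp_all add: translation_apply)
    then have "(inv\<^bsub>houghton n\<^esub> translation n i) (1, 1) = (1, 2)"
      "(inv\<^bsub>houghton n\<^esub> translation n i) (1, 2) = (1, 3)"
      using houghton_inv_apply[OF g, of "(1, 2)"] houghton_inv_apply[OF g, of "(1, 3)"] by simp_all
    then show ?thesis using g by (simp add: conj_by_transposition)
  qed
  show ?thesis
    unfolding base_transposition_eq
  proof
    show "?\<alpha> [^]\<^bsub>houghton n\<^esub> (2 :: nat) = \<one>\<^bsub>houghton n\<^esub>"
      by (rule houghton_eqI[of _ n]) (auto simp: numeral_2_eq_2 transpose_def)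
    show "(?\<alpha> \<otimes>\<^bsub>houghton n\<^esub> conj_by (houghton n) ?\<alpha> (translation n 1)) [^]\<^bsub>houghton n\<^esub> (3 :: nat)
      = \<one>\<^bsub>houghton n\<^esub>"
      unfolding conj1 by (rule houghton_eqI[of _ n]) (auto simp: numeral_3_eq_3 transpose_def)
    have "?\<alpha> \<otimes>\<^bsub>houghton n\<^esub> transposition n (2, 2) (2, 1)
      = \<one>\<^bsub>houghton n\<^esub> \<otimes>\<^bsub>houghton n\<^esub> transposition n (2, 2) (2, 1) \<otimes>\<^bsub>houghton n\<^esub> ?\<alpha>"
      by (rule houghton_eqI[of _ n]) (auto simp: transpose_def)
    then show "commutator (houghton n) ?\<alpha>
      (conj_by (houghton n) ?\<alpha> (translation n 1 [^]\<^bsub>houghton n\<^esub> (2 :: nat))) = \<one>\<^bsub>houghton n\<^esub>"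
      unfolding conj2 by (subst eq_commute, subst H.commutator_eq_iff) auto
    fix i j assume ij: "i \<in> {1..n - 1}" "j \<in> {1..n - 1}" "i \<noteq> j"
    then show "?\<alpha> = commutator (houghton n) (translation n i) (translation n j)"
      using translation_swap[OF ij] by (subst H.commutator_eq_iff) (auto simp: translation_closed)
    show "conj_by (houghton n) ?\<alpha> (inv\<^bsub>houghton n\<^esub> translation n i)
      = conj_by (houghton n) ?\<alpha> (inv\<^bsub>houghton n\<^esub> translation n j)"
      using ij by (simp add: conj_inv del: One_nat_def)
  qed (use assms in \<open>simp_all add: translation_closed\<close>)
qed

section \<open>Faithfulness of the realisation\<close>

text \<open>
  The homomorphism \<open>\<psi>\<close> is either the one from the presented group, whose kernel is to be
  determined, or the identity of \<open>houghton n\<close>, which makes the descriptions of the permutations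
  \<open>\<psi> (\<sigma> k)\<close> and \<open>\<psi> (g_prod as)\<close> available in \<open>houghton n\<close> itself.
\<close>

locale houghton_realisation = group_hom G "houghton n" \<psi> + houghton_relations G n g \<alpha>
  for G (structure) and n g \<alpha> and \<psi> +
  assumes realise_g: "i \<in> {1..n - 1} \<Longrightarrow> \<psi> (g i) = translation n i"
    and realise_alpha: "\<psi> \<alpha> = base_transposition n"
begin

lemma ray_1_in_Y [simp]: "(Suc 0, Suc k) \<in> Y n"
  using n_ge_3 by (simp add: Y_def)

lemma realise_sigma: "\<psi> (\<sigma> k) = transposition n (1, Suc k) (1, Suc (Suc k))"
proof (induction k)
  case 0
  show ?case by (simp add: sigma_0 realise_alpha base_transposition_eq numeral_2_eq_2)
next
  case (Suc k)
  have 1: "1 \<in> {1..n - 1}" using n_ge_3 by simp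
  have "\<psi> (\<sigma> (Suc k)) \<otimes>\<^bsub>houghton n\<^esub> \<psi> (g 1) = \<psi> (g 1) \<otimes>\<^bsub>houghton n\<^esub> \<psi> (\<sigma> k)"
    using sigma_shift[OF 1, of k] by (simp add: hom_mult [symmetric] del: hom_mult One_nat_def)
  also have "\<dots> = transposition n (1, Suc (Suc k)) (1, Suc (Suc (Suc k))) \<otimes>\<^bsub>houghton n\<^esub> \<psi> (g 1)"
    using 1 by (simp add: Suc realise_g transposition_mult translation_in_houghton translation_apply)
  finally show ?case by simp
qed

lemma sigma_prod_fixes_other_rays:
  assumes "z \<in> Y n" "fst z \<noteq> 1"
  shows "\<psi> (sigma_prod ps) z = z"
proof (induction ps)
  case (Cons k ps)
  have "transpose (1, Suc k) (1, Suc (Suc k)) z = z"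
    using assms by (auto simp: transpose_def)
  then show ?case using Cons assms by (simp add: realise_sigma)
qed (use assms in simp)

text \<open>
  Away from the first ray, positive words only translate outwards and no point leaves its ray. So a
  positive word acts there without exceptional points, and its letter counts can be read off.
\<close>

lemma g_prod_on_other_rays:
  assumes "set as \<subseteq> {1..n - 1}" "(j, p) \<in> Y n" "j \<noteq> 1"
  shows "\<psi> (g_prod as) (j, p) = (j, p + count_list as (j - 1))"
  using assms
proof (induction as arbitrary: p)
  case (Cons i as)
  then have i: "i \<in> {1..n - 1}" by simp
  have "(j, Suc p) \<in> Y n" using Cons.prems by (simp add: Y_def)
  then show ?case
    using Cons i by (auto simp: realise_g translation_apply)
qed simp

sublocale braid_action G \<sigma> \<psi> "\<lambda>q. (1, Suc q)"
proof
  fix k q :: nat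
  show "\<psi> (\<sigma> k) (1, Suc q) = (1, Suc (transpose k (Suc k) q))"
    by (simp add: realise_sigma transpose_def)
qed (auto intro: injI)

text \<open>
  Evaluate a normal form \<open>a\<inverse> s b\<close> of an element of the kernel: \<open>s b\<close> and \<open>a\<close> agree as permutations. As \<open>s\<close> fixes
  all rays but the first, the translation lengths there show that \<open>a\<close> and \<open>b\<close> have the same letters.
  So \<open>b = s' a\<close> and the element is a conjugate of \<open>s s'\<close>, which is trivial by the faithfulness of the
  Coxeter relations.
\<close>

theorem realisation_faithful:
  assumes "x \<in> generate G (insert \<alpha> (g ` {1..n - 1}))" "\<psi> x = \<one>\<^bsub>houghton n\<^esub>"
  shows "x = \<one>"
proof -
  obtain as ps bs where as: "set as \<subseteq> {1..n - 1}" and bs: "set bs \<subseteq> {1..n - 1}"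
    and x: "x = inv (g_prod as) \<otimes> sigma_prod ps \<otimes> g_prod bs"
    by (rule generated_normal_form[OF assms(1)])
  have "g_prod as \<otimes> x = sigma_prod ps \<otimes> g_prod bs"
    using as bs by (simp add: x G.m_assoc G.inv_mult_cancel_left)
  then have "\<psi> (g_prod as \<otimes> x) = \<psi> (sigma_prod ps \<otimes> g_prod bs)" by simp
  moreover have "x \<in> carrier G" using as bs by (simp add: x)
  ultimately have "\<psi> (g_prod as) \<otimes>\<^bsub>houghton n\<^esub> \<psi> x = \<psi> (sigma_prod ps) \<otimes>\<^bsub>houghton n\<^esub> \<psi> (g_prod bs)"
    using as bs by simp
  then have eq: "\<psi> (g_prod as) = \<psi> (sigma_prod ps) \<otimes>\<^bsub>houghton n\<^esub> \<psi> (g_prod bs)"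
    using as by (simp add: assms(2))
  have "count_list as i = count_list bs i" for i
  proof (cases "i \<in> {1..n - 1}")
    case True
    then have "(Suc i, 1) \<in> Y n" by (auto simp: Y_def)
    then show ?thesis
      using fun_cong[OF eq, of "(Suc i, 1)"] True as bs sigma_prod_fixes_other_rays[of "(Suc i, 1)" ps]
      by (simp add: g_prod_on_other_rays)
  next
    case False
    then have "i \<notin> set as" "i \<notin> set bs" using as bs by auto
    then show ?thesis by (simp add: count_list_0_iff)
  qed
  then have "mset as = mset bs" by (intro multiset_eqI) (simp add: count_mset)
  then obtain qs where qs: "g_prod bs = sigma_prod qs \<otimes> g_prod as"
    using g_prod_mset_eq[OF as] by blast
  have x': "x = inv (g_prod as) \<otimes> sigma_prod (ps @ qs) \<otimes> g_prod as"
    using as by (simp add: x qs sigma_prod_append G.m_assoc)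
  have "\<psi> (g_prod as) = \<psi> (sigma_prod (ps @ qs)) \<otimes>\<^bsub>houghton n\<^esub> \<psi> (g_prod as)"
    using as eq by (simp add: qs sigma_prod_append H.m_assoc)
  then have "\<psi> (sigma_prod (ps @ qs)) = \<one>\<^bsub>houghton n\<^esub>"
    using as by (metis H.l_cancel_one' H.r_cancel_one' g_prod_closed hom_closed sigma_prod_closed)
  then have "sigma_prod (ps @ qs) = \<one>"
    by (intro sigma_prod_faithful) simp
  then show ?thesis using as by (simp add: x')
qed

end

section \<open>Generation of Houghton's group\<close>

text \<open>
  The bijection maps \<open>{1..L}\<close>, the complement of the tail on which it is a shift, onto the complement
  \<open>{1..L + m}\<close> of the image of that tail. The two have the same number of elements.
\<close>

lemma eventual_shift_of_bijection_zero:
  fixes f :: "nat \<Rightarrow> nat" and m :: int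
  assumes "bij_betw f {1..} {1..}" and shift: "\<And>p. L < p \<Longrightarrow> int (f p) = int p + m"
  shows "m = 0"
proof -
  \<comment> \<open>This excludes truncation in \<open>nat (int L + m)\<close>.\<close>
  have "f (Suc L) \<ge> 1" using assms(1) by (auto dest: bij_betwE)
  then have L: "0 \<le> int L + m" using shift[of "Suc L"] by simp
  have tail: "f ` {L<..} = {nat (int L + m)<..}"
  proof
    show "f ` {L<..} \<subseteq> {nat (int L + m)<..}" using shift L by fastforce
    show "{nat (int L + m)<..} \<subseteq> f ` {L<..}"
    proof
      fix q assume q: "q \<in> {nat (int L + m)<..}"
      then have "L < nat (int q - m)" using L by auto
      moreover from this have "f (nat (int q - m)) = q" using shift[of "nat (int q - m)"] by linarith
      ultimately show "q \<in> f ` {L<..}" by (metis greaterThan_iff image_eqI)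
    qed
  qed
  have "f ` {1..L} = f ` ({1..} - {L<..})" by (rule arg_cong[of _ _ "image f"]) auto
  also have "\<dots> = f ` {1..} - f ` {L<..}"
    by (rule inj_on_image_set_diff[of f "{1..}"]) (use assms(1) in \<open>auto simp: bij_betw_def\<close>)
  also have "\<dots> = {1..nat (int L + m)}" using assms(1) by (auto simp: bij_betw_def tail)
  finally have "card (f ` {1..L}) = nat (int L + m)" by simp
  moreover have "card (f ` {1..L}) = L"
    using assms(1) by (subst card_image) (auto simp: bij_betw_def intro: inj_on_subset)
  ultimately show ?thesis using L by simp
qed

lemma eventual_translation_uniform:
  assumes "eventual_translation n h"
  shows "\<exists>(m :: nat \<Rightarrow> int) L. \<forall>k p. (k, p) \<in> Y n \<longrightarrow> L < p \<longrightarrow>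
    fst (h (k, p)) = k \<and> int (snd (h (k, p))) = int p + m k"
proof -
  obtain m K where K: "finite K"
    "\<And>k p. (k, p) \<in> Y n - K \<Longrightarrow> fst (h (k, p)) = k \<and> int (snd (h (k, p))) = int p + m k"
    using assms unfolding eventual_translation_def by fast
  obtain L where L: "\<forall>p \<in> snd ` K. p \<le> L"
    using finite_nat_set_iff_bounded_le[of "snd ` K"] K(1) by auto
  show ?thesis
  proof (intro exI[of _ m] exI[of _ L] allI impI)
    fix k p assume kp: "(k, p) \<in> Y n" "L < p"
    then have "(k, p) \<notin> K" using L by force
    then show "fst (h (k, p)) = k \<and> int (snd (h (k, p))) = int p + m k" using K(2) kp by blast
  qed
qed

lemma houghton_eventual_translation: "x \<in> carrier (houghton n) \<Longrightarrow> eventual_translation n x"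
  by (simp add: houghton_def)

lemma list_with_counts:
  fixes c :: "nat \<Rightarrow> nat"
  shows "\<exists>as. set as \<subseteq> {1..m} \<and> (\<forall>i \<in> {1..m}. count_list as i = c i)"
proof -
  obtain as where "mset as = (\<Sum>i\<in>{1..m}. replicate_mset (c i) i)"
    using ex_mset by blast
  then have count: "count_list as i = (if i \<in> {1..m} then c i else 0)" for i
    by (simp add: count_mset [symmetric] count_sum if_distrib sum.delta cong: if_cong)
  then have "set as \<subseteq> {1..m}"
    by (metis count_list_0_iff subsetI)
  then show ?thesis using count by auto
qed

context
  fixes n :: nat
  assumes n_ge_3: "n \<ge> 3"
begin

interpretation H: houghton_realisation "houghton n" n "translation n" "base_transposition n" id
proof -
  interpret houghton_relations "houghton n" n "translation n" "base_transposition n"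
    by (rule houghton_relations_houghton[OF n_ge_3])
  show "houghton_realisation (houghton n) n (translation n) (base_transposition n) id"
    by unfold_locales (auto simp: hom_def)
qed

text \<open>
  Sorting: a cycle of adjacent transpositions brings the image of the last moved point back to its
  place. The points of the first ray are numbered from \<open>0\<close> by the \<open>\<sigma> k\<close>, hence \<open>Suc m\<close> is point \<open>m\<close>.
\<close>

lemma ray_1_supported_is_sigma_prod:
  assumes "s \<in> carrier (houghton n)" "\<And>z. z \<in> Y n \<Longrightarrow> fst z \<noteq> 1 \<Longrightarrow> s z = z"
    "\<And>p. m < p \<Longrightarrow> s (1, p) = (1, p)"
  shows "\<exists>ps. s = H.sigma_prod ps"
  using assms
proof (induction m arbitrary: s)
  case 0
  have "s = \<one>\<^bsub>houghton n\<^esub>"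
  proof (rule houghton_eqI[of _ n])
    fix z assume z: "z \<in> Y n"
    then obtain j p where "z = (j, p)" "0 < p" by (auto simp: Y_def)
    then show "s z = \<one>\<^bsub>houghton n\<^esub> z" using 0(2)[of z] 0(3)[of p] z by (cases "j = 1") auto
  qed (use 0(1) in auto)
  then show ?case by (intro exI[of _ "[]"]) simp
next
  case (Suc m)
  have in_Y: "(1, Suc m) \<in> Y n" using H.ray_1_in_Y[of m] by simp
  have img: "s (1, Suc m) \<in> Y n" using Suc.prems(1) in_Y by simp
  obtain j q where jq: "s (1, Suc m) = (j, q)" by fastforce
  have jq_Y: "(j, q) \<in> Y n" using img jq by simp
  have moved: "s (j, q) \<noteq> (j, q) \<or> (j, q) = (1, Suc m)"
    using houghton_apply_eq_iff[OF Suc.prems(1) in_Y jq_Y] jq by metis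
  have j: "j = 1" using moved Suc.prems(2)[OF jq_Y] by auto
  have "q \<le> Suc m" using moved Suc.prems(3)[of q] j by fastforce
  moreover have "1 \<le> q" using jq_Y by (auto simp: Y_def)
  ultimately obtain k where k: "q = Suc k" "k \<le> m" by (cases q) auto
  let ?t = "H.sigma_prod [k..<m]"
  have descent: "set [k..<m] \<subseteq> {..<m}" by auto
  have "\<exists>ps. s \<otimes>\<^bsub>houghton n\<^esub> ?t = H.sigma_prod ps"
  proof (rule Suc.IH)
    show "s \<otimes>\<^bsub>houghton n\<^esub> ?t \<in> carrier (houghton n)" using Suc.prems(1) by simp
    show "(s \<otimes>\<^bsub>houghton n\<^esub> ?t) z = z" if "z \<in> Y n" "fst z \<noteq> 1" for z
      using that Suc.prems(2) H.sigma_prod_fixes_other_rays by simp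
    show "(s \<otimes>\<^bsub>houghton n\<^esub> ?t) (1, p) = (1, p)" if p: "m < p" for p
    proof (cases "p = Suc m")
      case True
      then show ?thesis
        using in_Y jq j k H.act_sigma_prod_descent[of k m] by simp
    next
      case False
      then obtain r where r: "p = Suc r" "m < r" using p by (cases p) auto
      then have "s (1, p) = (1, p)" using Suc.prems(3) by simp
      then show ?thesis
        using r H.act_sigma_prod_above[OF descent] H.ray_1_in_Y[of r] by simp
    qed
  qed
  then obtain ps where ps: "s \<otimes>\<^bsub>houghton n\<^esub> ?t = H.sigma_prod ps" by blast
  then have "s = H.sigma_prod ps \<otimes>\<^bsub>houghton n\<^esub> inv\<^bsub>houghton n\<^esub> ?t"
    using Suc.prems(1) by (intro iffD2[OF H.G.inv_solve_right]) auto
  then have "s = H.sigma_prod (ps @ rev [k..<m])"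
    by (simp add: H.inv_sigma_prod H.sigma_prod_append)
  then show ?case by blast
qed

lemma fixing_other_rays_is_sigma_prod:
  assumes "s \<in> carrier (houghton n)" and fixed: "\<And>z. z \<in> Y n \<Longrightarrow> fst z \<noteq> 1 \<Longrightarrow> s z = z"
  shows "\<exists>ps. s = H.sigma_prod ps"
proof -
  have in_Y: "(1, p) \<in> Y n \<longleftrightarrow> 1 \<le> p" for p using n_ge_3 by (auto simp: Y_def)
  obtain m :: "nat \<Rightarrow> int" and L where
    "\<forall>k p. (k, p) \<in> Y n \<longrightarrow> L < p \<longrightarrow> fst (s (k, p)) = k \<and> int (snd (s (k, p))) = int p + m k"
    using eventual_translation_uniform[OF houghton_eventual_translation[OF assms(1)]] by blast
  note mL = this [rule_format]
  have bij: "bij_betw s (Y n) (Y n)" using houghton_bij[OF assms(1)] .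
  have ray: "fst (s (1, p)) = 1" if "1 \<le> p" for p
  proof (rule ccontr)
    assume "fst (s (1, p)) \<noteq> 1"
    moreover have Y: "(1, p) \<in> Y n" "s (1, p) \<in> Y n" using that assms(1) in_Y by auto
    ultimately have "s (s (1, p)) = s (1, p)" using fixed by blast
    then have "s (1, p) = (1, p)" using houghton_apply_eq_iff[OF assms(1) Y(2,1)] by simp
    then show False using \<open>fst (s (1, p)) \<noteq> 1\<close> by simp
  qed
  let ?f = "\<lambda>p. snd (s (1, p))"
  have f: "s (1, p) = (1, ?f p)" if "1 \<le> p" for p
    using ray[OF that] by (metis prod.collapse)
  have "bij_betw ?f {1..} {1..}"
    unfolding bij_betw_def
  proof
    show "inj_on ?f {1..}"
    proof (rule inj_onI)
      fix p q :: nat assume pq: "p \<in> {1..}" "q \<in> {1..}" "?f p = ?f q"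
      then have "s (1, p) = s (1, q)" using f[of p] f[of q] by simp
      then show "p = q" using houghton_apply_eq_iff[OF assms(1)] pq in_Y by auto
    qed
    show "?f ` {1..} = {1..}"
    proof
      show "?f ` {1..} \<subseteq> {1..}"
      proof (rule image_subsetI)
        fix p :: nat assume "p \<in> {1..}"
        then have "s (1, p) \<in> Y n" using assms(1) in_Y by simp
        then show "?f p \<in> {1..}" by (auto simp: Y_def)
      qed
      show "{1..} \<subseteq> ?f ` {1..}"
      proof
        fix q :: nat assume "q \<in> {1..}"
        then have "(1, q) \<in> s ` Y n" using in_Y bij by (simp add: bij_betw_def)
        then obtain j p where jp: "(j, p) \<in> Y n" "s (j, p) = (1, q)" by fastforce
        then have "j = 1" using fixed[of "(j, p)"] by auto
        then show "q \<in> ?f ` {1..}" using jp in_Y by (auto intro!: image_eqI[of _ _ p])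
      qed
    qed
  qed
  moreover have "int (?f p) = int p + m 1" if "L < p" for p
    using mL[of 1 p] that in_Y by simp
  ultimately have "m 1 = 0" by (rule eventual_shift_of_bijection_zero)
  then have "s (1, p) = (1, p)" if "L < p" for p
    using mL[of 1 p] that in_Y by (intro prod_eqI) auto
  then show ?thesis using ray_1_supported_is_sigma_prod assms by blast
qed

text \<open>
  Beyond a common bound \<open>L\<close>, the element \<open>h\<close> translates each ray. Let \<open>a\<close> push every ray but the first outwards by
  \<open>L\<close>, past all exceptional points of \<open>h\<close>, and let \<open>b\<close> push ray \<open>j\<close> outwards by \<open>L + m j\<close>. Then \<open>a h\<close>
  and \<open>b\<close> agree on these rays, so \<open>s = a h b\<inverse>\<close> moves points of the first ray only. Such an \<open>s\<close> has no
  translation part there, since a bijection of a single ray cannot be an eventual proper shift.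
\<close>

theorem houghton_normal_form:
  assumes h: "h \<in> carrier (houghton n)"
  shows "\<exists>as ps bs. set as \<subseteq> {1..n - 1} \<and> set bs \<subseteq> {1..n - 1} \<and>
    h = inv\<^bsub>houghton n\<^esub> H.g_prod as \<otimes>\<^bsub>houghton n\<^esub> H.sigma_prod ps \<otimes>\<^bsub>houghton n\<^esub> H.g_prod bs"
proof -
  obtain m :: "nat \<Rightarrow> int" and L where
    "\<forall>k p. (k, p) \<in> Y n \<longrightarrow> L < p \<longrightarrow> fst (h (k, p)) = k \<and> int (snd (h (k, p))) = int p + m k"
    using eventual_translation_uniform[OF houghton_eventual_translation[OF h]] by blast
  note mL = this [rule_format]
  \<comment> \<open>A word can push ray \<open>j\<close> outwards only: the point \<open>(j, L + 1)\<close> must have its image on the ray.\<close>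
  have nonneg: "0 \<le> int L + m j" if "j \<in> {1..n}" for j
  proof -
    have Y: "(j, Suc L) \<in> Y n" using that by (simp add: Y_def)
    then have "h (j, Suc L) \<in> Y n" using h by simp
    then have "1 \<le> snd (h (j, Suc L))" by (auto simp: Y_def)
    then show ?thesis using mL[OF Y] by simp
  qed
  obtain as where as: "set as \<subseteq> {1..n - 1}" "\<And>i. i \<in> {1..n - 1} \<Longrightarrow> count_list as i = L"
    using list_with_counts[of "n - 1" "\<lambda>_. L"] by blast
  obtain bs where bs: "set bs \<subseteq> {1..n - 1}"
    "\<And>i. i \<in> {1..n - 1} \<Longrightarrow> count_list bs i = nat (int L + m (Suc i))"
    using list_with_counts[of "n - 1" "\<lambda>i. nat (int L + m (Suc i))"] by blast
  let ?A = "H.g_prod as" and ?B = "H.g_prod bs"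
  define s where "s = ?A \<otimes>\<^bsub>houghton n\<^esub> h \<otimes>\<^bsub>houghton n\<^esub> inv\<^bsub>houghton n\<^esub> ?B"
  have closed: "?A \<in> carrier (houghton n)" "?B \<in> carrier (houghton n)" "s \<in> carrier (houghton n)"
    using as bs h by (simp_all add: s_def)
  have sB: "s \<otimes>\<^bsub>houghton n\<^esub> ?B = ?A \<otimes>\<^bsub>houghton n\<^esub> h"
    using closed h by (simp add: s_def H.G.m_assoc)
  have "s z = z" if z: "z \<in> Y n" "fst z \<noteq> 1" for z
  proof -
    obtain j p where jp: "z = (j, p)" by fastforce
    have j: "j - 1 \<in> {1..n - 1}" "Suc (j - 1) = j" "j \<in> {1..n}" and p: "1 \<le> p"
      using z by (auto simp: jp Y_def)
    have Az: "?A z = (j, p + L)"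
      using H.g_prod_on_other_rays[OF as(1), of j p] z as(2)[OF j(1)] by (simp add: jp)
    have Bz: "?B z = (j, p + nat (int L + m j))"
      using H.g_prod_on_other_rays[OF bs(1), of j p] z bs(2)[OF j(1)] j by (simp add: jp)
    have Y: "(j, p + L) \<in> Y n" using j p by (simp add: Y_def)
    have "h (j, p + L) = (j, p + nat (int L + m j))"
      using mL[OF Y] nonneg[OF j(3)] p by (intro prod_eqI) auto
    then have "?B (s z) = ?B z"
      using fun_cong[OF sB, of z] z Az Bz by simp
    then show ?thesis using houghton_apply_eq_iff[OF closed(2), of "s z" z] z closed by simp
  qed
  then obtain ps where ps: "s = H.sigma_prod ps"
    using fixing_other_rays_is_sigma_prod[OF closed(3)] by blast
  have "h = inv\<^bsub>houghton n\<^esub> ?A \<otimes>\<^bsub>houghton n\<^esub> s \<otimes>\<^bsub>houghton n\<^esub> ?B"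
    using closed h by (simp add: H.G.m_assoc sB H.G.inv_mult_cancel_left)
  then show ?thesis using as bs ps by blast
qed

text \<open>
  Each \<open>\<sigma> k\<close> is an iterated conjugate of \<open>\<alpha>\<close>, so every factor of the normal form lies in the
  generated subgroup.
\<close>

theorem houghton_generated:
  "carrier (houghton n) \<subseteq>
     generate (houghton n) (insert (base_transposition n) (translation n ` {1..n - 1}))"
  (is "_ \<subseteq> ?gen")
proof
  have gens: "insert (base_transposition n) (translation n ` {1..n - 1}) \<subseteq> carrier (houghton n)"
    by (auto simp: translation_closed)
  interpret gen: subgroup ?gen "houghton n"
    by (rule H.G.generate_is_subgroup[OF gens])
  have g: "translation n i \<in> ?gen" if "i \<in> {1..n - 1}" for i
    using that by (intro generate.incl) auto
  have sigma: "H.\<sigma> k \<in> ?gen" for k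
  proof (induction k)
    case 0
    show ?case unfolding H.sigma_0 by (intro generate.incl) auto
  next
    case (Suc k)
    have "translation n 1 \<in> ?gen" using n_ge_3 by (intro g) auto
    then show ?case
      using Suc unfolding H.sigma_Suc H.conjugate_def
      by (intro gen.m_closed gen.m_inv_closed)
  qed
  have sigma_prod: "H.sigma_prod ps \<in> ?gen" for ps
    by (induction ps) (auto simp: sigma simp del: One_nat_def)
  have g_prod: "H.g_prod as \<in> ?gen" if "set as \<subseteq> {1..n - 1}" for as
    using that by (induction as) (auto simp: g simp del: One_nat_def)
  fix h assume "h \<in> carrier (houghton n)"
  then show "h \<in> ?gen"
    using houghton_normal_form[of h] sigma_prod g_prod by (auto simp del: One_nat_def)
qed

end

section \<open>The presentation\<close>

lemma (in group_hom) hom_conj_by: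
  assumes "x \<in> carrier G" "y \<in> carrier G"
  shows "h (conj_by G x y) = conj_by H (h x) (h y)"
  using assms by (simp add: conj_by_def)

lemma (in group_hom) hom_commutator:
  assumes "x \<in> carrier G" "y \<in> carrier G"
  shows "h (commutator G x y) = commutator H (h x) (h y)"
  using assms by (simp add: commutator_def)

lemma houghton_rels_closed:
  assumes "n \<ge> 3"
  shows "houghton_rels n \<subseteq> carrier (free_group (houghton_gens n)) \<times> carrier (free_group (houghton_gens n))"
proof -
  interpret F: group "free_group (houghton_gens n)" by (rule group_free_group)
  have "free_gen Alpha \<in> carrier (free_group (houghton_gens n))"
    by (simp add: houghton_gens_def free_gen_closed)
  moreover have "free_gen (Transl i) \<in> carrier (free_group (houghton_gens n))" if "i \<in> {1..n - 1}" for i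
    using that by (simp add: houghton_gens_def free_gen_closed)
  moreover have "1 \<in> {1..n - 1}" using assms by simp
  ultimately show ?thesis
    by (auto simp: houghton_rels_def Let_def conj_by_def commutator_def)
qed

lemma ball_pairs_iff:
  "(\<forall>(u, v) \<in> {(a i j, b i j) | i j. P i j}. Q u v) \<longleftrightarrow> (\<forall>i j. P i j \<longrightarrow> Q (a i j) (b i j))"
  by fastforce

text \<open>
  The relations are stated by products formed in the free group, while \<open>houghton_relations\<close> states them
  in a group \<open>K\<close>. The translation is needed in both directions: from \<open>houghton n\<close> to the relations
  between words, and from these to the presented group.
\<close>

lemma houghton_rels_iff_relations:
  assumes "n \<ge> 3" "group_hom (free_group (houghton_gens n)) K \<theta>"
    and g_eq: "\<And>i. i \<in> {1..n - 1} \<Longrightarrow> \<theta> (free_gen (Transl i)) = g i"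
    and alpha_eq: "\<theta> (free_gen Alpha) = \<alpha>"
  shows "(\<forall>(u, v) \<in> houghton_rels n. \<theta> u = \<theta> v) \<longleftrightarrow> houghton_relations K n g \<alpha>"
proof -
  interpret \<theta>: group_hom "free_group (houghton_gens n)" K \<theta> by fact
  have alpha [simp]: "free_gen Alpha \<in> carrier (free_group (houghton_gens n))"
    by (simp add: houghton_gens_def free_gen_closed)
  have g [simp]: "free_gen (Transl i) \<in> carrier (free_group (houghton_gens n))" if "i \<in> {1..n - 1}" for i
    using that by (simp add: houghton_gens_def free_gen_closed)
  have g1 [simp]: "free_gen (Transl 1) \<in> carrier (free_group (houghton_gens n))"
    using g[of 1] assms(1) by simp
  have [simp]: "conj_by (free_group (houghton_gens n)) x y \<in> carrier (free_group (houghton_gens n))"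
    if "x \<in> carrier (free_group (houghton_gens n))" "y \<in> carrier (free_group (houghton_gens n))" for x y
    using that by (simp add: conj_by_def)
  have g1_eq: "\<theta> (free_gen (Transl 1)) = g 1" using g_eq[of 1] assms(1) by simp
  have g_closed: "g i \<in> carrier K" if "i \<in> {1..n - 1}" for i
    using g_eq[OF that] g[OF that] \<theta>.hom_closed by metis
  have alpha_closed: "\<alpha> \<in> carrier K"
    using alpha_eq alpha \<theta>.hom_closed by metis
  have "houghton_relations K n g \<alpha> \<longleftrightarrow> houghton_relations_axioms K n g \<alpha>"
    by (simp add: houghton_relations_def \<theta>.H.is_group)
  also have "\<dots> \<longleftrightarrow> (\<forall>(u, v) \<in> houghton_rels n. \<theta> u = \<theta> v)"
    using assms(1)
    unfolding houghton_relations_axioms_def houghton_rels_def Let_def ball_Un ball_pairs_iff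
    by (simp add: \<theta>.hom_conj_by \<theta>.hom_commutator \<theta>.hom_nat_pow g_eq g1_eq alpha_eq g_closed
        alpha_closed del: One_nat_def atLeastAtMost_iff) blast
  finally show ?thesis by simp
qed

theorem theorem3:
  fixes n :: nat
  assumes "n \<ge> 3"
  shows "has_presentation (houghton n) (houghton_gens n) (houghton_rels n) (houghton_gen_image n)"
proof -
  let ?S = "houghton_gens n" and ?R = "houghton_rels n" and ?f = "houghton_gen_image n"
  let ?P = "presented_group ?S ?R"
  interpret H: houghton_relations "houghton n" n "translation n" "base_transposition n"
    by (rule houghton_relations_houghton[OF assms])
  interpret presentation ?S ?R
    by unfold_locales (rule houghton_rels_closed[OF assms])
  have f: "?f ` ?S \<subseteq> carrier (houghton n)"
    by (auto simp: houghton_gens_def translation_closed)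
  let ?\<epsilon> = "word_value (houghton n) ?f"
  have \<epsilon>: "group_hom (free_group ?S) (houghton n) ?\<epsilon>"
    by (rule H.word_value_hom[OF f])
  have \<epsilon>_gen: "?\<epsilon> (free_gen x) = ?f x" if "x \<in> ?S" for x
    by (rule H.word_value_free_gen[OF f that])
  have \<epsilon>_relations: "\<forall>(u, v) \<in> ?R. ?\<epsilon> u = ?\<epsilon> v"
    by (subst houghton_rels_iff_relations[OF assms \<epsilon>, of "translation n" "base_transposition n"])
       (use H.houghton_relations_axioms \<epsilon>_gen in \<open>auto simp: houghton_gens_def\<close>)
  show ?thesis
  proof (rule has_presentationI[OF \<epsilon>])
    show "?\<epsilon> u = ?\<epsilon> v" if "(u, v) \<in> ?R" for u v
      using that \<epsilon>_relations by auto
    show "?\<epsilon> (free_gen x) = ?f x" if "x \<in> ?S" for x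
      by (rule \<epsilon>_gen[OF that])
    show "carrier (houghton n) \<subseteq> generate (houghton n) (?f ` ?S)"
      using houghton_generated[OF assms] by (simp add: houghton_gens_def image_image)
    fix \<psi> z assume hom: "group_hom ?P (houghton n) \<psi>"
      and \<psi>: "\<And>x. x \<in> ?S \<Longrightarrow> \<psi> (presented_gen ?S ?R x) = ?f x"
      and z: "z \<in> carrier ?P" "\<psi> z = \<one>\<^bsub>houghton n\<^esub>"
    let ?g = "\<lambda>i. presented_gen ?S ?R (Transl i)" and ?\<alpha> = "presented_gen ?S ?R Alpha"
    have "houghton_relations ?P n ?g ?\<alpha>"
      using quotient_map_relation
      by (subst houghton_rels_iff_relations[OF assms quotient_map_hom, symmetric])
         (auto simp: presented_gen_def)
    then interpret P: houghton_realisation ?P n ?g ?\<alpha> \<psi>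
      using hom \<psi>
      by (simp add: houghton_realisation_def houghton_realisation_axioms_def houghton_gens_def)
    have "z \<in> generate ?P (insert ?\<alpha> (?g ` {1..n - 1}))"
      using z(1) presented_group_generated by (simp add: houghton_gens_def image_image)
    then show "z = \<one>\<^bsub>?P\<^esub>"
      using P.realisation_faithful z(2) by blast
  qed
qed

end
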